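(* Consider the second-order cone program $$\min_{\varphi,z,q}\ \{\langle c,\varphi\rangle+\delta_{\mathbb Q}(z)\mid \mathcal A\varphi-q=0,\ z-\mathcal B\mathcal Fq-\mathbf d=0\},$$ with $\varphi\in\mathbb R^{\mathcal G^c}$, $q\in\prod_{d=0}^D\mathbb R^{\mathcal G^s_d}$, $z\in(\mathbb R^{\mathcal G^s_0})^{4D+2}$, whose KKT system in the unknowns $(\varphi,z,q,\alpha,\beta)$, with $\alpha\in\prod_{d=0}^D\mathbb R^{\mathcal G^s_d}$ and $\beta\in(\mathbb R^{\mathcal G^s_0})^{4D+2}$, is $$\text{(KKT-SOC)}\qquad\begin{cases}\mathcal A\varphi=q,\quad z=\mathcal B\mathcal Fq+\mathbf d,\\ \mathcal A^*\alpha=-c,\quad \alpha+\mathcal F^*\mathcal B^*\beta=0,\\ \mathbb Q\ni z\perp\beta\in\mathbb Q.\end{cases}$$ Then the solution set of (KKT-SOC) is nonempty. Moreover, if $(\varphi,z,q,\alpha,\beta)$ is a solution of (KKT-SOC) and $\alpha=(\alpha_0;\bar\alpha)$ with $\alpha_0\in\mathbb R^{\mathcal G^s_0}$ and $\bar\alpha\in\prod_{d=1}^D\mathbb R^{\mathcal G^s_d}$, then $(\varphi,q,\Lambda_0,\bar\Lambda,\Lambda_q):=(\varphi,q,\alpha_0,\bar\alpha,-\alpha_0)$ is a solution of the KKT system $$\begin{cases}\mathcal A\varphi=q,\quad \mathcal A^*(\Lambda_0;\bar\Lambda)+c=0,\quad \Lambda_0+\Lambda_q=0,\\ 0\le\Lambda_0\perp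 q_0+\tfrac12\mathcal L_{\mathcal T}\mathcal L_{\mathcal X}^*(|q_1|^2;\dots;|q_D|^2)\le0,\\ \bar\Lambda_d=(\mathcal L^d_{\mathcal X}\mathcal L^*_{\mathcal T}\Lambda_0)\odot q_d,\quad d=1,\dots,D,\end{cases}$$ of the discretized dual dynamic optimal transport problem $\min_{\varphi,q}\{\langle c,\varphi\rangle\mid\mathcal A\varphi-q=0,\ q\in\mathbb P\}$.
   Context: Grid. Let $D\ge1$ and let $n_0,\dots,n_D$ be positive integers, $h_d:=1/n_d$, $X=[0,1]^D$. Put $J^c_d:=\{0,1,\dots,n_d\}$ and $J^s_d:=\{j-\tfrac12\mid j=1,\dots,n_d\}$. Define $\mathcal G^c_X:=J^c_1\times\dots\times J^c_D$, $\mathcal G^c:=J^c_0\times\mathcal G^c_X$, and, for $d=0,\dots,D$, $\mathcal G^s_d:=J^c_0\times\dots\times J^c_{d-1}\times J^s_d\times J^c_{d+1}\times\dots\times J^c_D$. Indices are written $i=(i_0,\dots,i_D)$; $\mathbb R^{\mathcal G}$ is the Euclidean space of real vectors indexed by $\mathcal G$. Let $e_0,\dots,e_D$ be the standard basis vectors of $\mathbb R^{D+1}$ (the $(d+1)$-th component of $e_d$ is $1$). Operators. $\mathcal A\varphi:=(\mathcal A_0\varphi;\dots;\mathcal A_D\varphi)$ with $\mathcal A_d:\mathbb R^{\mathcal G^c}\to\mathbb R^{\mathcal G^s_d}$, $(\mathcal A_d\varphi)_i:=\frac1{h_d}(\varphi_{i+e_d/2}-\varphi_{i-e_d/2})$.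 $\mathcal L_{\mathcal T}:\mathbb R^{\mathcal G^c}\to\mathbb R^{\mathcal G^s_0}$, $(\mathcal L_{\mathcal T}y)_i:=\frac12(y_{i-e_0/2}+y_{i+e_0/2})$; for $d=1,\dots,D$, $\mathcal L^d_{\mathcal X}:\mathbb R^{\mathcal G^c}\to\mathbb R^{\mathcal G^s_d}$, $(\mathcal L^d_{\mathcal X}y)_i:=\frac12(y_{i-e_d/2}+y_{i+e_d/2})$. A superscript $*$ denotes the adjoint with respect to the Euclidean inner products, and $\mathcal L^*_{\mathcal X}(v_1;\dots;v_D):=\sum_{d=1}^D(\mathcal L^d_{\mathcal X})^*v_d$ for $v_d\in\mathbb R^{\mathcal G^s_d}$. For $q=(q_0;\dots;q_D)$ with $q_d\in\mathbb R^{\mathcal G^s_d}$, $\mathcal Fq:=(\mathcal F_0q_0;\mathcal F^1_1q_1;\dots;\mathcal F^1_4q_1;\dots;\mathcal F^D_1q_D;\dots;\mathcal F^D_4q_D)\in(\mathbb R^{\mathcal G^s_0})^{4D+1}$, where $\mathcal F_0q_0=q_0$ and for $d=1,\dots,D$, $i\in\mathcal G^s_0$: $(\mathcal F^d_1q_d)_i=(q_d)_{i-(e_0+e_d)/2}$ if $i_d\ge1$ and $0$ if $i_d=0$; $(\mathcal F^d_2q_d)_i=(q_d)_{i-(e_0-e_d)/2}$ if $i_d\le n_d-1$ and $0$ if $i_d=n_d$; $(\mathcal F^d_3q_d)_i=(q_d)_{i+(e_0-e_d)/2}$ if $i_d\ge1$ and $0$ if $i_d=0$; $(\mathcal F^d_4q_d)_i=(q_d)_{i+(e_0+e_d)/2}$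 if $i_d\le n_d-1$ and $0$ if $i_d=n_d$. For $\tilde q=(\tilde q_0;\dots;\tilde q_{4D})\in(\mathbb R^{\mathcal G^s_0})^{4D+1}$, $\mathcal B\tilde q:=(-\tilde q_0;\tfrac{\sqrt2}2\tilde q_1;\dots;\tfrac{\sqrt2}2\tilde q_{4D};\tilde q_0)\in(\mathbb R^{\mathcal G^s_0})^{4D+2}$. The vector $\mathbf d\in(\mathbb R^{\mathcal G^s_0})^{4D+2}$ has first and last blocks equal to the all-ones vector and all other blocks zero. Cones. $\mathbb K_{\rm soc}:=\{(y_0;\bar y)\in\mathbb R\times\mathbb R^{4D+1}\mid y_0\ge\|\bar y\|\}$, and $\mathbb Q:=\{(\beta_1;\dots;\beta_{4D+2})\in(\mathbb R^{\mathcal G^s_0})^{4D+2}\mid((\beta_1)_i;\dots;(\beta_{4D+2})_i)\in\mathbb K_{\rm soc}\ \forall i\in\mathcal G^s_0\}$; $\delta_{\mathbb Q}$ is the indicator function ($0$ on $\mathbb Q$, $+\infty$ elsewhere). Data. $\rho_0,\rho_1$ are Borel probability measures on $X$. For $\bar i=(i_1,\dots,i_D)\in\mathcal G^c_X$ let $X_{\bar i}:=\{y\in X\mid|i_dh_d-y_d|\le h_d/2,\ d=1,\dots,D\}$. The measures of these cells are assumed to satisfy $\sum_{\bar i\in\mathcal G^c_X}\rho_0(X_{\bar i})=\sum_{\bar i\in\mathcal G^c_X}\rho_1(X_{\bar i})=1$ (no mass on overlaps of cells is counted twice). The vector $c\in\mathbb R^{\mathcal G^c}$ is given by $c_{(i_0,\bar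 i)}:=\rho_0(X_{\bar i})$ if $i_0=0$, $c_{(i_0,\bar i)}:=-\rho_1(X_{\bar i})$ if $i_0=n_0$, and $c_{(i_0,\bar i)}:=0$ otherwise. Constraint set. $\mathbb P:=\{q=(q_0;\dots;q_D)\mid q_d\in\mathbb R^{\mathcal G^s_d},\ (q_0)_i+\frac12(\mathcal L_{\mathcal T}\mathcal L^*_{\mathcal X}(|q_1|^2;\dots;|q_D|^2))_i\le0\ \ \forall i\in\mathcal G^s_0\}$, where $|x|^2$ denotes the vector of componentwise squares. $\odot$ is the componentwise product, inequalities between vectors are componentwise, and $a\perp b$ means $\langle a,b\rangle=0$. *)

theory Defs
  imports "HOL-Probability.Probability"
begin

text \<open>
  Grid indices are functions \<open>nat \<Rightarrow> real\<close>, extensional outside the coordinates \<open>{0..D}\<close>, with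
  literal half-integer entries at staggered positions, so that \<open>i + e\<^sub>d/2\<close> is
  \<open>i(d := i d + 1/2)\<close>. Coordinate 0 is time; coordinates \<open>1..D\<close> are space.
\<close>

type_synonym idx = "nat \<Rightarrow> real"

definition hstep :: "(nat \<Rightarrow> nat) \<Rightarrow> nat \<Rightarrow> real" where
  "hstep n d = 1 / real (n d)"

definition Jc :: "(nat \<Rightarrow> nat) \<Rightarrow> nat \<Rightarrow> real set" where
  "Jc n d = real ` {0..n d}"

definition Js :: "(nat \<Rightarrow> nat) \<Rightarrow> nat \<Rightarrow> real set" where
  "Js n d = (\<lambda>j. real j - 1/2) ` {1..n d}"

definition GcX :: "nat \<Rightarrow> (nat \<Rightarrow> nat) \<Rightarrow> idx set" where
  "GcX D n = (\<Pi>\<^sub>E d\<in>{1..D}. Jc n d)"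

definition Gc :: "nat \<Rightarrow> (nat \<Rightarrow> nat) \<Rightarrow> idx set" where
  "Gc D n = (\<Pi>\<^sub>E d\<in>{0..D}. Jc n d)"

definition Gs :: "nat \<Rightarrow> (nat \<Rightarrow> nat) \<Rightarrow> nat \<Rightarrow> idx set" where
  "Gs D n d = (\<Pi>\<^sub>E k\<in>{0..D}. if k = d then Js n k else Jc n k)"

text \<open>
  The space of real vectors indexed by \<open>I\<close> is represented by the extensional functions on \<open>I\<close>.
  A block vector is a vector over a set of pairs (block number, index within the block), so
  \<open>rvec\<close>, \<open>ip\<close> and \<open>adj\<close> apply uniformly to plain vectors and to block vectors.
\<close>

definition rvec :: "'i set \<Rightarrow> ('i \<Rightarrow> real) set" where
  "rvec I = I \<rightarrow>\<^sub>E UNIV"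

definition ip :: "'i set \<Rightarrow> ('i \<Rightarrow> real) \<Rightarrow> ('i \<Rightarrow> real) \<Rightarrow> real" where
  "ip I x y = (\<Sum>i\<in>I. x i * y i)"

text \<open>
  \<open>adj I J L\<close> is the Euclidean adjoint of a linear \<open>L\<close> from \<open>rvec I\<close> to \<open>rvec J\<close>
  (\<open>I\<close>, \<open>J\<close> finite). The library's \<open>adjoint\<close> is confined to functions between whole types.
\<close>

definition adj ::
  "'i set \<Rightarrow> 'j set \<Rightarrow> (('i \<Rightarrow> real) \<Rightarrow> ('j \<Rightarrow> real)) \<Rightarrow> ('j \<Rightarrow> real) \<Rightarrow> ('i \<Rightarrow> real)" where
  "adj I J L y = (THE u. u \<in> rvec I \<and> (\<forall>x\<in>rvec I. ip J (L x) y = ip I x u))"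

definition Stag :: "nat \<Rightarrow> (nat \<Rightarrow> nat) \<Rightarrow> (nat \<times> idx) set" where
  "Stag D n = (SIGMA d:{0..D}. Gs D n d)"

definition StagX :: "nat \<Rightarrow> (nat \<Rightarrow> nat) \<Rightarrow> (nat \<times> idx) set" where
  "StagX D n = (SIGMA d:{1..D}. Gs D n d)"

text \<open>Block numbers: \<open>0..4D\<close> for the range of \<open>\<F>\<close>, \<open>1..4D+2\<close> for the range of \<open>\<B>\<close>.\<close>

definition FIdx :: "nat \<Rightarrow> (nat \<Rightarrow> nat) \<Rightarrow> (nat \<times> idx) set" where
  "FIdx D n = {0..4*D} \<times> Gs D n 0"

definition BIdx :: "nat \<Rightarrow> (nat \<Rightarrow> nat) \<Rightarrow> (nat \<times> idx) set" where
  "BIdx D n = {1..4*D+2} \<times> Gs D n 0"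

definition block :: "nat \<Rightarrow> (nat \<Rightarrow> nat) \<Rightarrow> (nat \<times> idx \<Rightarrow> real) \<Rightarrow> nat \<Rightarrow> idx \<Rightarrow> real" where
  "block D n q d = (\<lambda>i\<in>Gs D n d. q (d, i))"

text \<open>\<open>join_blocks D n v0 vb\<close> is the block vector \<open>(v\<^sub>0; v\<^sub>1; \<dots>; v\<^sub>D)\<close> with \<open>vb = (v\<^sub>1; \<dots>; v\<^sub>D)\<close>.\<close>

definition join_blocks ::
  "nat \<Rightarrow> (nat \<Rightarrow> nat) \<Rightarrow> (idx \<Rightarrow> real) \<Rightarrow> (nat \<times> idx \<Rightarrow> real) \<Rightarrow> nat \<times> idx \<Rightarrow> real" where
  "join_blocks D n v0 vb = (\<lambda>(d, i)\<in>Stag D n. if d = 0 then v0 i else vb (d, i))"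

definition Aop :: "nat \<Rightarrow> (nat \<Rightarrow> nat) \<Rightarrow> (idx \<Rightarrow> real) \<Rightarrow> nat \<times> idx \<Rightarrow> real" where
  "Aop D n \<phi> = (\<lambda>(d, i)\<in>Stag D n.
     1 / hstep n d * (\<phi> (i(d := i d + 1/2)) - \<phi> (i(d := i d - 1/2))))"

definition LT :: "nat \<Rightarrow> (nat \<Rightarrow> nat) \<Rightarrow> (idx \<Rightarrow> real) \<Rightarrow> idx \<Rightarrow> real" where
  "LT D n y = (\<lambda>i\<in>Gs D n 0. 1/2 * (y (i(0 := i 0 - 1/2)) + y (i(0 := i 0 + 1/2))))"

definition LX :: "nat \<Rightarrow> (nat \<Rightarrow> nat) \<Rightarrow> nat \<Rightarrow> (idx \<Rightarrow> real) \<Rightarrow> idx \<Rightarrow> real" where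
  "LX D n d y = (\<lambda>i\<in>Gs D n d. 1/2 * (y (i(d := i d - 1/2)) + y (i(d := i d + 1/2))))"

definition LT_adj :: "nat \<Rightarrow> (nat \<Rightarrow> nat) \<Rightarrow> (idx \<Rightarrow> real) \<Rightarrow> idx \<Rightarrow> real" where
  "LT_adj D n = adj (Gc D n) (Gs D n 0) (LT D n)"

definition LX_adj :: "nat \<Rightarrow> (nat \<Rightarrow> nat) \<Rightarrow> (nat \<times> idx \<Rightarrow> real) \<Rightarrow> idx \<Rightarrow> real" where
  "LX_adj D n v = (\<lambda>j\<in>Gc D n. \<Sum>d=1..D. adj (Gc D n) (Gs D n d) (LX D n d) (block D n v d) j)"

text \<open>\<open>Fpart D n d k\<close> is \<open>\<F>\<^sup>d\<^sub>k\<close> for \<open>k = 1, 2, 3, 4\<close>.\<close>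

definition Fpart ::
  "nat \<Rightarrow> (nat \<Rightarrow> nat) \<Rightarrow> nat \<Rightarrow> nat \<Rightarrow> (idx \<Rightarrow> real) \<Rightarrow> idx \<Rightarrow> real" where
  "Fpart D n d k v = (\<lambda>i\<in>Gs D n 0.
     if k = 1 then (if i d \<ge> 1 then v (i(0 := i 0 - 1/2, d := i d - 1/2)) else 0)
     else if k = 2 then (if i d \<le> real (n d) - 1 then v (i(0 := i 0 - 1/2, d := i d + 1/2)) else 0)
     else if k = 3 then (if i d \<ge> 1 then v (i(0 := i 0 + 1/2, d := i d - 1/2)) else 0)
     else (if i d \<le> real (n d) - 1 then v (i(0 := i 0 + 1/2, d := i d + 1/2)) else 0))"

text \<open>Block \<open>4(d - 1) + k\<close> of \<open>\<F> q\<close> is \<open>\<F>\<^sup>d\<^sub>k q\<^sub>d\<close>, for \<open>1 \<le> d \<le> D\<close> and \<open>1 \<le> k \<le> 4\<close>.\<close>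

definition Fop :: "nat \<Rightarrow> (nat \<Rightarrow> nat) \<Rightarrow> (nat \<times> idx \<Rightarrow> real) \<Rightarrow> nat \<times> idx \<Rightarrow> real" where
  "Fop D n q = (\<lambda>(m, i)\<in>FIdx D n.
     if m = 0 then q (0, i)
     else let d = (m - 1) div 4 + 1; k = (m - 1) mod 4 + 1
          in Fpart D n d k (block D n q d) i)"

definition Bop :: "nat \<Rightarrow> (nat \<Rightarrow> nat) \<Rightarrow> (nat \<times> idx \<Rightarrow> real) \<Rightarrow> nat \<times> idx \<Rightarrow> real" where
  "Bop D n r = (\<lambda>(m, i)\<in>BIdx D n.
     if m = 1 then - r (0, i)
     else if m = 4*D+2 then r (0, i)
     else sqrt 2 / 2 * r (m - 1, i))"

definition dvec :: "nat \<Rightarrow> (nat \<Rightarrow> nat) \<Rightarrow> nat \<times> idx \<Rightarrow> real" where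
  "dvec D n = (\<lambda>(m, i)\<in>BIdx D n. if m = 1 \<or> m = 4*D+2 then 1 else 0)"

definition Ksoc :: "nat \<Rightarrow> (nat \<Rightarrow> real) set" where
  "Ksoc D = {y \<in> rvec {0..4*D+1}. y 0 \<ge> L2_set y {1..4*D+1}}"

definition Qcone :: "nat \<Rightarrow> (nat \<Rightarrow> nat) \<Rightarrow> (nat \<times> idx \<Rightarrow> real) set" where
  "Qcone D n = {\<beta> \<in> rvec (BIdx D n). \<forall>i\<in>Gs D n 0. (\<lambda>k\<in>{0..4*D+1}. \<beta> (k + 1, i)) \<in> Ksoc D}"

text \<open>
  \<open>X = [0,1]\<^sup>D\<close> sits in \<open>nat \<Rightarrow> real\<close> (product topology) as extensional functions on \<open>{1..D}\<close>;
  its subspace topology is that of \<open>[0,1]\<^sup>D\<close>, so the trace of \<open>borel\<close> is its Borel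
  sigma-algebra.
\<close>

definition unit_box :: "nat \<Rightarrow> (nat \<Rightarrow> real) set" where
  "unit_box D = (\<Pi>\<^sub>E d\<in>{1..D}. {0..1})"

definition borel_prob :: "nat \<Rightarrow> (nat \<Rightarrow> real) measure \<Rightarrow> bool" where
  "borel_prob D \<rho> \<longleftrightarrow> prob_space \<rho> \<and> sets \<rho> = sets (restrict_space borel (unit_box D))"

definition cell :: "nat \<Rightarrow> (nat \<Rightarrow> nat) \<Rightarrow> idx \<Rightarrow> (nat \<Rightarrow> real) set" where
  "cell D n i = {y \<in> unit_box D. \<forall>d\<in>{1..D}. \<bar>i d * hstep n d - y d\<bar> \<le> hstep n d / 2}"

definition cvec ::
  "nat \<Rightarrow> (nat \<Rightarrow> nat) \<Rightarrow> (nat \<Rightarrow> real) measure \<Rightarrow> (nat \<Rightarrow> real) measure \<Rightarrow> idx \<Rightarrow> real" where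
  "cvec D n \<rho>0 \<rho>1 = (\<lambda>i\<in>Gc D n.
     if i 0 = 0 then measure \<rho>0 (cell D n (restrict i {1..D}))
     else if i 0 = real (n 0) then - measure \<rho>1 (cell D n (restrict i {1..D}))
     else 0)"

text \<open>
  KKT system, in the unknowns \<open>(\<phi>, z, q, \<alpha>, \<beta>)\<close>, of the second-order cone program
  \<open>min \<langle>c, \<phi>\<rangle> + \<delta>\<^sub>Q(z)\<close> subject to \<open>\<A> \<phi> - q = 0\<close>, \<open>z - \<B> \<F> q - d = 0\<close>.
\<close>

definition kkt_soc ::
  "nat \<Rightarrow> (nat \<Rightarrow> nat) \<Rightarrow> (idx \<Rightarrow> real) \<Rightarrow>
   ((idx \<Rightarrow> real) \<times> (nat \<times> idx \<Rightarrow> real) \<times> (nat \<times> idx \<Rightarrow> real) \<times>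
    (nat \<times> idx \<Rightarrow> real) \<times> (nat \<times> idx \<Rightarrow> real)) set" where
  "kkt_soc D n c = {(\<phi>, z, q, \<alpha>, \<beta>).
     \<phi> \<in> rvec (Gc D n) \<and> z \<in> rvec (BIdx D n) \<and> q \<in> rvec (Stag D n) \<and>
     \<alpha> \<in> rvec (Stag D n) \<and> \<beta> \<in> rvec (BIdx D n) \<and>
     Aop D n \<phi> = q \<and>
     (\<forall>p\<in>BIdx D n. z p = Bop D n (Fop D n q) p + dvec D n p) \<and>
     (\<forall>i\<in>Gc D n. adj (Gc D n) (Stag D n) (Aop D n) \<alpha> i = - c i) \<and>
     (\<forall>p\<in>Stag D n. \<alpha> p + adj (Stag D n) (FIdx D n) (Fop D n)
                              (adj (FIdx D n) (BIdx D n) (Bop D n) \<beta>) p = 0) \<and>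
     z \<in> Qcone D n \<and> ip (BIdx D n) z \<beta> = 0 \<and> \<beta> \<in> Qcone D n}"

text \<open>The vector \<open>q\<^sub>0 + 1/2 \<L>\<^sub>T \<L>\<^sub>X\<^sup>*(|q\<^sub>1|\<^sup>2; \<dots>; |q\<^sub>D|\<^sup>2)\<close>.\<close>

definition constr :: "nat \<Rightarrow> (nat \<Rightarrow> nat) \<Rightarrow> (nat \<times> idx \<Rightarrow> real) \<Rightarrow> idx \<Rightarrow> real" where
  "constr D n q = (\<lambda>i\<in>Gs D n 0.
     q (0, i) + 1/2 * LT D n (LX_adj D n (\<lambda>p\<in>StagX D n. (q p)\<^sup>2)) i)"

text \<open>
  KKT system, in the unknowns \<open>(\<phi>, q, \<Lambda>\<^sub>0, \<Lambda>b, \<Lambda>\<^sub>q)\<close>, of the discretized dual dynamic optimal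
  transport problem \<open>min \<langle>c, \<phi>\<rangle>\<close> subject to \<open>\<A> \<phi> - q = 0\<close>, \<open>constr q \<le> 0\<close>.
\<close>

definition kkt_dot ::
  "nat \<Rightarrow> (nat \<Rightarrow> nat) \<Rightarrow> (idx \<Rightarrow> real) \<Rightarrow>
   ((idx \<Rightarrow> real) \<times> (nat \<times> idx \<Rightarrow> real) \<times> (idx \<Rightarrow> real) \<times>
    (nat \<times> idx \<Rightarrow> real) \<times> (idx \<Rightarrow> real)) set" where
  "kkt_dot D n c = {(\<phi>, q, \<Lambda>0, \<Lambda>b, \<Lambda>q).
     \<phi> \<in> rvec (Gc D n) \<and> q \<in> rvec (Stag D n) \<and>
     \<Lambda>0 \<in> rvec (Gs D n 0) \<and> \<Lambda>b \<in> rvec (StagX D n) \<and> \<Lambda>q \<in> rvec (Gs D n 0) \<and>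
     Aop D n \<phi> = q \<and>
     (\<forall>i\<in>Gc D n. adj (Gc D n) (Stag D n) (Aop D n) (join_blocks D n \<Lambda>0 \<Lambda>b) i + c i = 0) \<and>
     (\<forall>i\<in>Gs D n 0. \<Lambda>0 i + \<Lambda>q i = 0) \<and>
     (\<forall>i\<in>Gs D n 0. 0 \<le> \<Lambda>0 i) \<and>
     ip (Gs D n 0) \<Lambda>0 (constr D n q) = 0 \<and>
     (\<forall>i\<in>Gs D n 0. constr D n q i \<le> 0) \<and>
     (\<forall>d\<in>{1..D}. \<forall>i\<in>Gs D n d. \<Lambda>b (d, i) = LX D n d (LT_adj D n \<Lambda>0) i * q (d, i))}"

end

theory Submission
  imports Defs
begin

text \<open>
  At a node \<open>i\<close> the slack of the cone program is \<open>(1 - q\<^sub>0; (\<F> q)'/\<surd>2; 1 + q\<^sub>0)\<close>, where \<open>(\<F> q)'\<close> consists of the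
  \<open>4D\<close> entries of \<open>\<F> q\<close> from the space blocks. Its Lorentz form is \<open>-4\<close> times
  \<open>q\<^sub>0 + 1/8 |(\<F> q)'|\<^sup>2\<close>, and this last expression is the constraint function \<open>q\<^sub>0 + 1/2 \<L>\<^sub>T \<L>\<^sub>X\<^sup>* |q|\<^sup>2\<close>, because
  \<open>\<L>\<^sub>T \<L>\<^sub>X\<^sup>*\<close> averages over exactly the staggered points that \<open>\<F>\<close> collects (\<open>LT_LX_adjoint\<close>,
  \<open>slack_tail\<close>). So the cone program is the transport problem with its constraints rewritten.

  The multipliers correspond as well. Two orthogonal nonzero vectors of the second-order cone are
  reflections of each other up to a positive factor (\<open>soc_complementary\<close>), and the slack is nonzero;
  hence \<open>\<beta>\<close> is at each node a multiple \<open>s \<ge> 0\<close> of the reflected slack. Testing \<open>\<alpha> = -\<F>\<^sup>* \<B>\<^sup>* \<beta>\<close> with unit vectors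
  (\<open>reflected_multiplier_weak_form\<close>) shows \<open>\<alpha>\<^sub>0 = 2 s\<close> and the formula for the fluxes, and
  complementarity of \<open>z\<close> and \<open>\<beta>\<close> becomes complementarity of \<open>\<alpha>\<^sub>0\<close> and the constraint
  (\<open>kkt_soc_imp_kkt_dot\<close>).

  Conversely, multipliers of the quadratic constraints yield a solution of the cone system, so existence
  is a question about a convex program with finitely many quadratic constraints in the potential
  alone. It is settled by a quadratic penalty (\<open>kkt_by_penalty\<close>). Two compactness facts are
  needed. The multipliers are bounded since they sum to the value of the objective at the potential \<open>-t\<close>: test
  stationarity with that potential (\<open>time_ramp\<close>). The minimizers are bounded, up to an
  additive constant, by comparison with the uniform density, which is strictly positive; discrete
  connectedness of the grid replaces the solution of a Poisson problem for the corresponding flux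
  (\<open>sublevel_bounded\<close>).
\<close>

section \<open>Linear forms in finitely many coordinates\<close>

text \<open>Grid functions have no vector-space structure as a type, so linearity is recorded by coefficients.
  The argument is an arbitrary function; only its values on \<open>I\<close> count. This one predicate yields
  linearity, continuity in the product topology, and the existence of adjoints.\<close>
definition lin_form :: "'i set \<Rightarrow> (('i \<Rightarrow> real) \<Rightarrow> real) \<Rightarrow> bool" where
  "lin_form I L \<longleftrightarrow> (\<exists>w. \<forall>x. L x = (\<Sum>j\<in>I. w j * x j))"

lemma lin_form_coord:
  assumes "finite I" "j \<in> I"
  shows "lin_form I (\<lambda>x. x j)"
  unfolding lin_form_def
proof (intro exI allI)
  fix x :: "'a \<Rightarrow> real"
  show "x j = (\<Sum>k\<in>I. (if k = j then 1 else 0) * x k)"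
    using assms by (simp add: if_distrib[of "\<lambda>u. u * _"] cong: if_cong)
qed

lemma lin_form_zero: "lin_form I (\<lambda>x. 0)"
  unfolding lin_form_def by (rule exI[of _ "\<lambda>_. 0"]) simp

lemma lin_form_diff:
  assumes "lin_form I L" "lin_form I L'"
  shows "lin_form I (\<lambda>x. L x - L' x)"
proof -
  obtain w w' where "\<forall>x. L x = (\<Sum>j\<in>I. w j * x j)" "\<forall>x. L' x = (\<Sum>j\<in>I. w' j * x j)"
    using assms unfolding lin_form_def by auto
  then show ?thesis unfolding lin_form_def
    by (intro exI[of _ "\<lambda>j. w j - w' j"]) (simp add: left_diff_distrib sum_subtractf)
qed

lemma lin_form_cmult:
  assumes "lin_form I L"
  shows "lin_form I (\<lambda>x. a * L x)"
proof -
  obtain w where "\<forall>x. L x = (\<Sum>j\<in>I. w j * x j)"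
    using assms unfolding lin_form_def by auto
  then show ?thesis unfolding lin_form_def
    by (intro exI[of _ "\<lambda>j. a * w j"]) (simp add: sum_distrib_left mult.assoc)
qed

lemma lin_form_add:
  assumes "lin_form I L" "lin_form I L'"
  shows "lin_form I (\<lambda>x. L x + L' x)"
  using lin_form_diff[OF assms(1) lin_form_cmult[OF assms(2), of "-1"]] by simp

lemma lin_form_compose:
  assumes L: "lin_form J L" and T: "\<And>j. j \<in> J \<Longrightarrow> lin_form I (\<lambda>x. T x j)"
  shows "lin_form I (\<lambda>x. L (T x))"
proof -
  obtain w where w: "\<And>x. L x = (\<Sum>j\<in>J. w j * x j)" using L unfolding lin_form_def by auto
  obtain V where V: "\<And>j x. j \<in> J \<Longrightarrow> T x j = (\<Sum>i\<in>I. V j i * x i)"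
    using T unfolding lin_form_def by metis
  have "L (T x) = (\<Sum>i\<in>I. (\<Sum>j\<in>J. w j * V j i) * x i)" for x
  proof -
    have "L (T x) = (\<Sum>j\<in>J. \<Sum>i\<in>I. w j * V j i * x i)"
      unfolding w by (rule sum.cong) (simp_all add: V sum_distrib_left mult.assoc)
    also have "\<dots> = (\<Sum>i\<in>I. (\<Sum>j\<in>J. w j * V j i) * x i)"
      by (subst sum.swap) (simp add: sum_distrib_right)
    finally show ?thesis .
  qed
  then show ?thesis unfolding lin_form_def by (intro exI[of _ "\<lambda>i. \<Sum>j\<in>J. w j * V j i"]) simp
qed

lemma lin_form_line:
  assumes "lin_form I L"
  shows "L (\<lambda>j. x j + s * y j) = L x + s * L y"
proof -
  obtain w where "\<forall>x. L x = (\<Sum>j\<in>I. w j * x j)"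
    using assms unfolding lin_form_def by auto
  then show ?thesis
    by (simp add: distrib_left sum.distrib sum_distrib_left mult.left_commute)
qed

lemma lin_form_at_zero:
  assumes "lin_form I L"
  shows "L (\<lambda>j. 0) = 0"
  using assms unfolding lin_form_def by auto

lemma lin_form_cong:
  assumes "lin_form I L" "\<And>j. j \<in> I \<Longrightarrow> x j = y j"
  shows "L x = L y"
  using assms unfolding lin_form_def by (metis (no_types, lifting) sum.cong)

lemma lin_form_continuous:
  assumes "lin_form I L"
  shows "continuous_on UNIV L"
proof -
  obtain w where "\<forall>x. L x = (\<Sum>j\<in>I. w j * x j)"
    using assms unfolding lin_form_def by auto
  then have "L = (\<lambda>x. \<Sum>j\<in>I. w j * x j)" by auto
  then show ?thesis
    by (simp only:) (intro continuous_intros continuous_on_product_coordinates)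
qed

lemma lin_form_tendsto:
  assumes "lin_form I L" "\<And>j. j \<in> I \<Longrightarrow> (\<lambda>k. X k j) \<longlonglongrightarrow> x j"
  shows "(\<lambda>k. L (X k)) \<longlonglongrightarrow> L x"
proof -
  obtain w where "\<forall>x. L x = (\<Sum>j\<in>I. w j * x j)"
    using assms unfolding lin_form_def by auto
  then show ?thesis using assms(2) by (auto intro!: tendsto_intros)
qed

section \<open>Multipliers by penalization\<close>

lemma finite_coords_subsequence:
  fixes X :: "nat \<Rightarrow> 'i \<Rightarrow> real"
  assumes "finite I" and "\<And>k j. j \<in> I \<Longrightarrow> \<bar>X k j\<bar> \<le> R j"
  shows "\<exists>r x. strict_mono r \<and> (\<forall>j\<in>I. (\<lambda>k. X (r k) j) \<longlonglongrightarrow> x j)"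
  using assms
proof (induction I rule: finite_induct)
  case empty
  show ?case by (rule exI[of _ id]) (simp add: strict_mono_def)
next
  case (insert a I)
  then obtain r x where r: "strict_mono r" "\<forall>j\<in>I. (\<lambda>k. X (r k) j) \<longlonglongrightarrow> x j" by auto
  have "bounded (range (\<lambda>k. X (r k) a))"
    unfolding bounded_iff using insert.prems[of a] by auto
  then obtain l s where s: "strict_mono s" "((\<lambda>k. X (r k) a) \<circ> s) \<longlonglongrightarrow> l"
    using bounded_imp_convergent_subsequence by blast
  show ?case
  proof (intro exI conjI ballI)
    show "strict_mono (r \<circ> s)" using r s by (simp add: strict_mono_o)
    fix j assume "j \<in> insert a I"
    then show "(\<lambda>k. X ((r \<circ> s) k) j) \<longlonglongrightarrow> (x(a := l)) j"
      using s LIMSEQ_subseq_LIMSEQ[OF _ s(1)] r(2) insert.hyps by (force simp: o_def)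
  qed
qed

text \<open>Since \<open>P\<close> sees only the coordinates in \<open>I\<close>, the others may be frozen at \<open>0\<close>; the box
  becomes a product of compact sets over all coordinates, and Tychonoff's theorem applies.\<close>
lemma continuous_attains_inf_box:
  fixes P :: "('i \<Rightarrow> real) \<Rightarrow> real"
  assumes "continuous_on UNIV P" "R \<ge> 0"
    and "\<And>x y. (\<And>j. j \<in> I \<Longrightarrow> x j = y j) \<Longrightarrow> P x = P y"
  shows "\<exists>x. (\<forall>j\<in>I. \<bar>x j\<bar> \<le> R) \<and> (\<forall>y. (\<forall>j\<in>I. \<bar>y j\<bar> \<le> R) \<longrightarrow> P x \<le> P y)"
proof -
  define S where "S = (\<Pi>\<^sub>E j\<in>UNIV. if j \<in> I then {-R..R} else {0::real})"
  have "compactin (product_topology (\<lambda>_. euclidean) UNIV) S"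
    unfolding S_def compactin_PiE by auto
  then have "compact S"
    by (simp add: euclidean_product_topology compactin_euclidean_iff)
  moreover have "(\<lambda>_. 0) \<in> S" using assms(2) by (auto simp: S_def)
  moreover have "continuous_on S P" using assms(1) continuous_on_subset by blast
  ultimately obtain x where x: "x \<in> S" "\<forall>y\<in>S. P x \<le> P y"
    using continuous_attains_inf[of S P] by blast
  show ?thesis
  proof (intro exI conjI allI ballI impI)
    show "\<bar>x j\<bar> \<le> R" if "j \<in> I" for j
      using x(1) that unfolding S_def by (force dest: PiE_mem[of _ _ _ j])
    fix y assume "\<forall>j\<in>I. \<bar>y j\<bar> \<le> R"
    then have "(\<lambda>j. if j \<in> I then y j else 0) \<in> S"
      unfolding S_def by (auto simp: abs_le_iff minus_le_iff)
    then have "P x \<le> P (\<lambda>j. if j \<in> I then y j else 0)" using x by blast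
    also have "\<dots> = P y" by (rule assms(3)) simp
    finally show "P x \<le> P y" .
  qed
qed

text \<open>This bound lets a smooth function, touching at \<open>v = 0\<close>, dominate the squared positive part, so that
  a minimizer of a penalized function is stationary without differentiating \<open>max\<close>.\<close>
lemma max_zero_add_square: "(max 0 (u + v))\<^sup>2 \<le> (max 0 u + v)\<^sup>2" for u v :: real
proof (cases "u + v \<le> 0")
  case False
  show ?thesis
  proof (cases "u \<ge> 0")
    case False
    then have "\<bar>u + v\<bar> \<le> \<bar>v\<bar>" using \<open>\<not> u + v \<le> 0\<close> by auto
    then show ?thesis using False \<open>\<not> u + v \<le> 0\<close> by (simp add: abs_le_square_iff)
  qed (use False in auto)
qed auto

text \<open>The shape of the constraints of the transport problem, as functions of the potential.\<close>
definition quad :: "'m set \<Rightarrow> (('i \<Rightarrow> real) \<Rightarrow> real) \<Rightarrow> ('m \<Rightarrow> ('i \<Rightarrow> real) \<Rightarrow> real) \<Rightarrow> ('i \<Rightarrow> real) \<Rightarrow> real"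
  where "quad M L B x = L x + 1/2 * (\<Sum>m\<in>M. (B m x)\<^sup>2)"

text \<open>The derivative of \<open>quad M L B\<close> at \<open>x\<close> in the direction \<open>y\<close>.\<close>
definition dquad :: "'m set \<Rightarrow> (('i \<Rightarrow> real) \<Rightarrow> real) \<Rightarrow> ('m \<Rightarrow> ('i \<Rightarrow> real) \<Rightarrow> real) \<Rightarrow>
    ('i \<Rightarrow> real) \<Rightarrow> ('i \<Rightarrow> real) \<Rightarrow> real"
  where "dquad M L B x y = L y + (\<Sum>m\<in>M. B m x * B m y)"

lemma quad_line:
  assumes "lin_form I L" "\<And>m. m \<in> M \<Longrightarrow> lin_form I (B m)"
  shows "quad M L B (\<lambda>j. x j + s * y j) =
    quad M L B x + s * dquad M L B x y + s\<^sup>2 * (1/2 * (\<Sum>m\<in>M. (B m y)\<^sup>2))"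
proof -
  have "(\<Sum>m\<in>M. (B m (\<lambda>j. x j + s * y j))\<^sup>2) = (\<Sum>m\<in>M. (B m x + s * B m y)\<^sup>2)"
    by (rule sum.cong) (simp_all add: lin_form_line[OF assms(2)])
  also have "\<dots> = (\<Sum>m\<in>M. (B m x)\<^sup>2) + s * (2 * (\<Sum>m\<in>M. B m x * B m y)) + s\<^sup>2 * (\<Sum>m\<in>M. (B m y)\<^sup>2)"
    by (simp add: power2_sum power_mult_distrib sum.distrib sum_distrib_left algebra_simps)
  finally show ?thesis
    by (simp add: quad_def dquad_def lin_form_line[OF assms(1)] algebra_simps)
qed

text \<open>Restrict the penalized function to the line through \<open>x\<close> in the direction \<open>y\<close>. Replacing each squared
  positive part by its majorant from \<open>max_zero_add_square\<close> gives a polynomial in the line parameter that lies above it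
  and agrees with it at \<open>0\<close>; so the polynomial has its minimum at \<open>0\<close> too, and its derivative there,
  which is the left-hand side of the conclusion, vanishes.\<close>
lemma penalty_stationary:
  fixes f :: "('i \<Rightarrow> real) \<Rightarrow> real"
  assumes f: "lin_form I f" and L: "\<And>i. i \<in> G \<Longrightarrow> lin_form I (L i)"
    and B: "\<And>i m. i \<in> G \<Longrightarrow> m \<in> M \<Longrightarrow> lin_form I (B i m)"
    and min: "\<And>y. f x + \<kappa>/2 * (\<Sum>i\<in>G. (max 0 (quad M (L i) (B i) x))\<^sup>2)
                  \<le> f y + \<kappa>/2 * (\<Sum>i\<in>G. (max 0 (quad M (L i) (B i) y))\<^sup>2)"
    and \<kappa>: "\<kappa> \<ge> 0"
  shows "f y + (\<Sum>i\<in>G. \<kappa> * max 0 (quad M (L i) (B i) x) * dquad M (L i) (B i) x y) = 0"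
proof -
  define g where "g i = quad M (L i) (B i) x" for i
  define a where "a i = dquad M (L i) (B i) x y" for i
  define b where "b i = 1/2 * (\<Sum>m\<in>M. (B i m y)\<^sup>2)" for i
  define h where "h s = f x + s * f y + \<kappa>/2 * (\<Sum>i\<in>G. (max 0 (g i) + (s * a i + s\<^sup>2 * b i))\<^sup>2)" for s
  have "h 0 \<le> h s" for s
  proof -
    have "h 0 \<le> f (\<lambda>j. x j + s * y j) + \<kappa>/2 * (\<Sum>i\<in>G. (max 0 (quad M (L i) (B i) (\<lambda>j. x j + s * y j)))\<^sup>2)"
      using min[of "\<lambda>j. x j + s * y j"] by (simp add: h_def g_def)
    also have "\<dots> \<le> h s"
      unfolding h_def lin_form_line[OF f] 
    proof (intro add_left_mono mult_left_mono sum_mono)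
      fix i assume i: "i \<in> G"
      have "quad M (L i) (B i) (\<lambda>j. x j + s * y j) = g i + (s * a i + s\<^sup>2 * b i)"
        using quad_line[OF L[OF i], of M "B i" x s y] B[OF i] by (simp add: g_def a_def b_def)
      then show "(max 0 (quad M (L i) (B i) (\<lambda>j. x j + s * y j)))\<^sup>2
          \<le> (max 0 (g i) + (s * a i + s\<^sup>2 * b i))\<^sup>2"
        using max_zero_add_square by simp
    qed (use \<kappa> in auto)
    finally show ?thesis .
  qed
  moreover have "(h has_real_derivative
      (f y + \<kappa>/2 * (\<Sum>i\<in>G. 2 * max 0 (g i) * a i))) (at 0)"
    unfolding h_def by (auto intro!: derivative_eq_intros sum.cong)
  ultimately have "f y + \<kappa>/2 * (\<Sum>i\<in>G. 2 * max 0 (g i) * a i) = 0"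
    by (intro DERIV_local_min[of h _ 0 1]) auto
  then show ?thesis by (simp add: g_def a_def sum_distrib_left algebra_simps)
qed

text \<open>Minimize \<open>f\<close> plus \<open>k/2\<close> times the squared constraint violations. The value at \<open>0\<close> is \<open>0\<close>, so the
  minimizers lie in a sublevel set that shrinks with \<open>k\<close>. This set may be unbounded, but by the last
  hypothesis every point of it can be moved into a fixed box without changing \<open>f\<close> or the constraints,
  so minimizers exist and can be chosen in that box. The multipliers are \<open>k\<close> times the violations. Along \<open>e\<close> all
  constraints decrease at unit speed wherever one starts, so stationarity tested with \<open>e\<close> says that the
  multipliers sum to \<open>f e\<close>, and they are bounded. In the limit along a subsequence the violations
  vanish, because \<open>k\<close> times them stays bounded, and the stationarity equations persist.\<close>
theorem kkt_by_penalty: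
  fixes f :: "('i \<Rightarrow> real) \<Rightarrow> real" and L :: "'g \<Rightarrow> ('i \<Rightarrow> real) \<Rightarrow> real"
    and B :: "'g \<Rightarrow> 'm \<Rightarrow> ('i \<Rightarrow> real) \<Rightarrow> real"
  assumes fin: "finite I" "finite G"
    and f: "lin_form I f" and L: "\<And>i. i \<in> G \<Longrightarrow> lin_form I (L i)"
    and B: "\<And>i m. i \<in> G \<Longrightarrow> m \<in> M \<Longrightarrow> lin_form I (B i m)"
    and descent: "\<And>i. i \<in> G \<Longrightarrow> L i e = -1" "\<And>i m. i \<in> G \<Longrightarrow> m \<in> M \<Longrightarrow> B i m e = 0"
    and R: "R \<ge> 0"
    and bdd: "\<And>x. f x + 1/2 * (\<Sum>i\<in>G. (max 0 (quad M (L i) (B i) x))\<^sup>2) \<le> 0 \<Longrightarrow>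
      \<exists>y. (\<forall>j\<in>I. \<bar>y j\<bar> \<le> R) \<and> f y = f x \<and> (\<forall>i\<in>G. quad M (L i) (B i) y = quad M (L i) (B i) x)"
  shows "\<exists>x \<nu>. (\<forall>i\<in>G. 0 \<le> \<nu> i \<and> quad M (L i) (B i) x \<le> 0 \<and> \<nu> i * quad M (L i) (B i) x = 0) \<and>
     (\<forall>y. f y + (\<Sum>i\<in>G. \<nu> i * dquad M (L i) (B i) x y) = 0)"
proof -
  let ?g = "\<lambda>i. quad M (L i) (B i)" and ?dg = "\<lambda>i. dquad M (L i) (B i)"
  define P where "P k x = f x + real (Suc k) / 2 * (\<Sum>i\<in>G. (max 0 (?g i x))\<^sup>2)" for k x
  have g0: "?g i (\<lambda>_. 0) = 0" if "i \<in> G" for i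
    using lin_form_at_zero[OF L[OF that]] lin_form_at_zero[OF B[OF that]] by (simp add: quad_def)
  have P0: "P k (\<lambda>_. 0) = 0" for k
    using lin_form_at_zero[OF f] g0 by (simp add: P_def)
  have gcont: "continuous_on UNIV (?g i)" if "i \<in> G" for i
    unfolding quad_def
    by (intro continuous_intros lin_form_continuous[OF L[OF that]] lin_form_continuous[OF B[OF that]])
  have gcong: "?g i x = ?g i y" if "i \<in> G" "\<And>j. j \<in> I \<Longrightarrow> x j = y j" for i x y
    unfolding quad_def
    using lin_form_cong[OF L[OF that(1)] that(2)] lin_form_cong[OF B[OF that(1)] that(2)]
    by (auto intro!: sum.cong)
  have "\<exists>x. (\<forall>j\<in>I. \<bar>x j\<bar> \<le> R) \<and> (\<forall>y. P k x \<le> P k y)" for k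
  proof -
    have "continuous_on UNIV (P k)"
      unfolding P_def by (intro continuous_intros lin_form_continuous[OF f] gcont)
    moreover have "P k x = P k y" if "\<And>j. j \<in> I \<Longrightarrow> x j = y j" for x y
      unfolding P_def using lin_form_cong[OF f that] gcong[OF _ that] by (auto intro!: sum.cong)
    ultimately obtain x where x: "\<forall>j\<in>I. \<bar>x j\<bar> \<le> R" "\<forall>y. (\<forall>j\<in>I. \<bar>y j\<bar> \<le> R) \<longrightarrow> P k x \<le> P k y"
      using continuous_attains_inf_box[OF _ R, of "P k" I] by blast
    have "P k x \<le> P k y" for y
    proof (cases "P k y \<le> 0")
      case True
      \<comment> \<open>\<open>P 0\<close> carries the weight \<open>1/2\<close>, since the penalty parameter is \<open>Suc k\<close>.\<close>
      have "P 0 y \<le> P k y"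
        unfolding P_def by (intro add_left_mono mult_right_mono sum_nonneg) auto
      then have "f y + 1/2 * (\<Sum>i\<in>G. (max 0 (?g i y))\<^sup>2) \<le> 0"
        using True by (simp add: P_def)
      then obtain z where "\<forall>j\<in>I. \<bar>z j\<bar> \<le> R" "f z = f y" "\<forall>i\<in>G. ?g i z = ?g i y"
        using bdd by blast
      then show ?thesis using x(2)[rule_format, of z] by (simp add: P_def)
    next
      case False
      have "P k x \<le> P k (\<lambda>_. 0)" using x(2) R by simp
      then show ?thesis using False P0 by simp
    qed
    then show ?thesis using x(1) by blast
  qed
  then obtain X where X: "\<And>k j. j \<in> I \<Longrightarrow> \<bar>X k j\<bar> \<le> R" "\<And>k y. P k (X k) \<le> P k y"
    by metis
  define \<mu> where "\<mu> k i = real (Suc k) * max 0 (?g i (X k))" for k i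
  have stat: "f y + (\<Sum>i\<in>G. \<mu> k i * ?dg i (X k) y) = 0" for k y
    unfolding \<mu>_def
    by (rule penalty_stationary[OF f L B]) (use X(2)[of k, unfolded P_def] in auto)
  have \<mu>0: "\<mu> k i \<ge> 0" for k i by (simp add: \<mu>_def)
  have \<mu>b: "\<bar>\<mu> k i\<bar> \<le> f e" if "i \<in> G" for k i
  proof -
    have "(\<Sum>i\<in>G. \<mu> k i * ?dg i (X k) e) = (\<Sum>i\<in>G. - \<mu> k i)"
      by (rule sum.cong) (simp_all add: dquad_def descent)
    then have "(\<Sum>i\<in>G. \<mu> k i) = f e" using stat[of e k] by (simp add: sum_negf)
    then show ?thesis
      using member_le_sum[of i G "\<mu> k"] \<mu>0 that fin by auto
  qed
  obtain r x where r: "strict_mono r" "\<And>j. j \<in> I \<Longrightarrow> (\<lambda>k. X (r k) j) \<longlonglongrightarrow> x j"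
    using finite_coords_subsequence[of I X "\<lambda>_. R"] fin X(1) by blast
  obtain s \<nu> where s: "strict_mono s" "\<And>i. i \<in> G \<Longrightarrow> (\<lambda>k. \<mu> (r (s k)) i) \<longlonglongrightarrow> \<nu> i"
    using finite_coords_subsequence[of G "\<lambda>k. \<mu> (r k)" "\<lambda>_. f e"] fin \<mu>b by blast
  have t: "strict_mono (r \<circ> s)" using r s by (simp add: strict_mono_o)
  have Xl: "(\<lambda>k. X (r (s k)) j) \<longlonglongrightarrow> x j" if "j \<in> I" for j
    using LIMSEQ_subseq_LIMSEQ[OF r(2)[OF that] s(1)] by (simp add: o_def)
  have gl: "(\<lambda>k. ?g i (X (r (s k)))) \<longlonglongrightarrow> ?g i x" if "i \<in> G" for i
    unfolding quad_def
    by (intro tendsto_intros lin_form_tendsto[OF L[OF that]] lin_form_tendsto[OF B[OF that]] Xl)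
  have dgl: "(\<lambda>k. ?dg i (X (r (s k))) y) \<longlonglongrightarrow> ?dg i x y" if "i \<in> G" for i y
    unfolding dquad_def
    by (intro tendsto_intros lin_form_tendsto[OF L[OF that]] lin_form_tendsto[OF B[OF that]] Xl)
  have inv: "(\<lambda>k. inverse (real (Suc (r (s k))))) \<longlonglongrightarrow> 0"
    using LIMSEQ_subseq_LIMSEQ[OF LIMSEQ_inverse_real_of_nat t] by (simp add: o_def)
  have pos: "(\<lambda>k. max 0 (?g i (X (r (s k))))) \<longlonglongrightarrow> 0" if "i \<in> G" for i
  proof -
    have "(\<lambda>k. \<mu> (r (s k)) i * inverse (real (Suc (r (s k))))) \<longlonglongrightarrow> \<nu> i * 0"
      by (intro tendsto_mult s(2) inv that)
    moreover have "\<mu> (r (s k)) i * inverse (real (Suc (r (s k)))) = max 0 (?g i (X (r (s k))))" for k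
      unfolding \<mu>_def by (simp add: nonzero_eq_divide_eq divide_inverse[symmetric] mult.commute del: of_nat_Suc)
    ultimately show ?thesis by (simp only: mult_zero_right)
  qed
  show ?thesis
  proof (intro exI conjI ballI allI)
    fix i assume i: "i \<in> G"
    show "0 \<le> \<nu> i"
      by (rule tendsto_lowerbound[OF s(2)[OF i]]) (auto simp: \<mu>0)
    have "(\<lambda>k. max 0 (?g i (X (r (s k))))) \<longlonglongrightarrow> max 0 (?g i x)"
      by (intro tendsto_intros gl i)
    then have "max 0 (?g i x) = 0" using pos[OF i] LIMSEQ_unique by blast
    then show "?g i x \<le> 0" by simp
    have "(\<lambda>k. \<mu> (r (s k)) i * ?g i (X (r (s k)))) \<longlonglongrightarrow> \<nu> i * ?g i x"
      by (intro tendsto_mult s(2) gl i)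
    moreover have "\<mu> k i * ?g i (X k) = \<mu> k i * max 0 (?g i (X k))" for k
      by (simp add: \<mu>_def max_def)
    moreover have "(\<lambda>k. \<mu> (r (s k)) i * max 0 (?g i (X (r (s k))))) \<longlonglongrightarrow> \<nu> i * 0"
      by (intro tendsto_mult s(2) pos i)
    ultimately show "\<nu> i * ?g i x = 0" using LIMSEQ_unique by fastforce
  next
    fix y
    have "(\<lambda>k. f y + (\<Sum>i\<in>G. \<mu> (r (s k)) i * ?dg i (X (r (s k))) y))
        \<longlonglongrightarrow> f y + (\<Sum>i\<in>G. \<nu> i * ?dg i x y)"
      by (intro tendsto_intros s(2) dgl)
    then show "f y + (\<Sum>i\<in>G. \<nu> i * ?dg i x y) = 0"
      by (simp add: stat LIMSEQ_const_iff)
  qed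
qed

section \<open>Shifts between the centred and the staggered grids\<close>

lemma Jc_iff: "x \<in> Jc n d \<longleftrightarrow> (\<exists>m\<le>n d. x = real m)"
  by (auto simp: Jc_def)

lemma Js_iff: "x \<in> Js n d \<longleftrightarrow> (\<exists>m<n d. x = real m + 1/2)"
proof
  assume "x \<in> Js n d"
  then obtain j where "1 \<le> j" "j \<le> n d" "x = real j - 1/2" by (auto simp: Js_def)
  then show "\<exists>m<n d. x = real m + 1/2" by (intro exI[of _ "j - 1"]) auto
next
  assume "\<exists>m<n d. x = real m + 1/2"
  then obtain m where "m < n d" "x = real m + 1/2" by auto
  then show "x \<in> Js n d" by (auto simp: Js_def image_iff intro!: bexI[of _ "Suc m"])
qed

lemma Js_half_up: "x \<in> Js n d \<Longrightarrow> x + 1/2 \<in> Jc n d"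
  unfolding Js_iff Jc_iff by (metis Suc_leI add.assoc field_sum_of_halves of_nat_Suc add.commute)

lemma Js_half_down: "x \<in> Js n d \<Longrightarrow> x - 1/2 \<in> Jc n d"
  unfolding Js_iff Jc_iff by (metis add_diff_cancel_right' less_imp_le)

lemma Jc_half_up: "x \<in> Jc n d \<Longrightarrow> x + 1/2 \<in> Js n d \<longleftrightarrow> x \<le> real (n d) - 1"
  unfolding Js_iff Jc_iff by auto

lemma Jc_half_down: "x \<in> Jc n d \<Longrightarrow> x - 1/2 \<in> Js n d \<longleftrightarrow> 1 \<le> x"
proof -
  assume "x \<in> Jc n d"
  then obtain m where m: "m \<le> n d" "x = real m" unfolding Jc_iff by auto
  show ?thesis
  proof
    assume "1 \<le> x"
    then show "x - 1/2 \<in> Js n d"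
      unfolding Js_iff using m by (intro exI[of _ "m - 1"]) auto
  qed (use m in \<open>auto simp: Js_iff\<close>)
qed

lemma Gc_iff: "x \<in> Gc D n \<longleftrightarrow> (\<forall>k. if k \<le> D then x k \<in> Jc n k else x k = undefined)"
  by (auto simp: Gc_def PiE_iff extensional_def)

lemma Gs_iff: "x \<in> Gs D n d \<longleftrightarrow>
    (\<forall>k. if k \<le> D then x k \<in> (if k = d then Js n k else Jc n k) else x k = undefined)"
  by (auto simp: Gs_def PiE_iff extensional_def)

lemma GcX_iff: "x \<in> GcX D n \<longleftrightarrow> (\<forall>k. if 1 \<le> k \<and> k \<le> D then x k \<in> Jc n k else x k = undefined)"
  by (auto simp: GcX_def PiE_iff extensional_def)

lemma finite_Jc: "finite (Jc n d)" and finite_Js: "finite (Js n d)"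
  by (auto simp: Jc_def Js_def)

lemma finite_grids:
  "finite (Gc D n)" "finite (GcX D n)" "finite (Gs D n d)"
  "finite (Stag D n)" "finite (StagX D n)" "finite (FIdx D n)" "finite (BIdx D n)"
  by (auto simp: Gc_def GcX_def Gs_def Stag_def StagX_def FIdx_def BIdx_def finite_Jc finite_Js
      intro!: finite_PiE finite_SigmaI)

lemma Gs_shift:
  assumes "j \<in> Gs D n d" "d \<le> D"
  shows "j(d := j d + 1/2) \<in> Gc D n" "j(d := j d - 1/2) \<in> Gc D n"
  using assms Js_half_up[of "j d" n d] Js_half_down[of "j d" n d]
  unfolding Gs_iff Gc_iff by (auto simp del: One_nat_def split: if_splits)

lemma Gc_shift:
  assumes "x \<in> Gc D n" "d \<le> D"
  shows "x(d := x d + 1/2) \<in> Gs D n d \<longleftrightarrow> x d \<le> real (n d) - 1"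
    and "x(d := x d - 1/2) \<in> Gs D n d \<longleftrightarrow> 1 \<le> x d"
  using assms Jc_half_up[of "x d" n d] Jc_half_down[of "x d" n d]
  unfolding Gs_iff Gc_iff by (auto split: if_splits)

text \<open>A shift by half a step maps the staggered grid bijectively onto the centred grid without one of its
  two faces orthogonal to direction \<open>d\<close>. The adjoint of \<open>\<L>\<^sub>X\<close> and telescoping in
  time reduce to these two reindexings.\<close>
lemma sum_shift:
  assumes "d \<le> D"
  shows "(\<Sum>j\<in>Gs D n d. y (j(d := j d - 1/2)) * w j) =
      (\<Sum>x\<in>Gc D n. y x * (if x d \<le> real (n d) - 1 then w (x(d := x d + 1/2)) else 0))"
    and "(\<Sum>j\<in>Gs D n d. y (j(d := j d + 1/2)) * w j) =
      (\<Sum>x\<in>Gc D n. y x * (if 1 \<le> x d then w (x(d := x d - 1/2)) else (0::real)))"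
proof -
  have "(\<Sum>j\<in>Gs D n d. y (j(d := j d - 1/2)) * w j) =
      (\<Sum>x\<in>{x \<in> Gc D n. x d \<le> real (n d) - 1}. y x * w (x(d := x d + 1/2)))"
  proof (rule sum.reindex_bij_witness[of _ "\<lambda>x. x(d := x d + 1/2)" "\<lambda>j. j(d := j d - 1/2)"])
    fix j assume j: "j \<in> Gs D n d"
    have "(j(d := j d - 1/2)) \<in> Gc D n" using Gs_shift(2)[OF j assms] .
    moreover have "(j(d := j d - 1/2))(d := (j(d := j d - 1/2)) d + 1/2) = j" by auto
    ultimately show "j(d := j d - 1/2) \<in> {x \<in> Gc D n. x d \<le> real (n d) - 1}"
      using Gc_shift(1)[OF _ assms] j by (metis (mono_tags, lifting) mem_Collect_eq)
  qed (use Gc_shift(1)[OF _ assms] in auto)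
  also have "\<dots> = (\<Sum>x\<in>Gc D n. y x * (if x d \<le> real (n d) - 1 then w (x(d := x d + 1/2)) else 0))"
    by (rule sum.mono_neutral_cong_left) (auto simp: finite_grids)
  finally show "(\<Sum>j\<in>Gs D n d. y (j(d := j d - 1/2)) * w j) =
      (\<Sum>x\<in>Gc D n. y x * (if x d \<le> real (n d) - 1 then w (x(d := x d + 1/2)) else 0))" .
  have "(\<Sum>j\<in>Gs D n d. y (j(d := j d + 1/2)) * w j) =
      (\<Sum>x\<in>{x \<in> Gc D n. 1 \<le> x d}. y x * w (x(d := x d - 1/2)))"
  proof (rule sum.reindex_bij_witness[of _ "\<lambda>x. x(d := x d - 1/2)" "\<lambda>j. j(d := j d + 1/2)"])
    fix j assume j: "j \<in> Gs D n d"
    have "(j(d := j d + 1/2)) \<in> Gc D n" using Gs_shift(1)[OF j assms] .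
    moreover have "(j(d := j d + 1/2))(d := (j(d := j d + 1/2)) d - 1/2) = j" by auto
    ultimately show "j(d := j d + 1/2) \<in> {x \<in> Gc D n. 1 \<le> x d}"
      using Gc_shift(2)[OF _ assms] j by (metis (mono_tags, lifting) mem_Collect_eq)
  qed (use Gc_shift(2)[OF _ assms] in auto)
  also have "\<dots> = (\<Sum>x\<in>Gc D n. y x * (if 1 \<le> x d then w (x(d := x d - 1/2)) else 0))"
    by (rule sum.mono_neutral_cong_left) (auto simp: finite_grids)
  finally show "(\<Sum>j\<in>Gs D n d. y (j(d := j d + 1/2)) * w j) =
      (\<Sum>x\<in>Gc D n. y x * (if 1 \<le> x d then w (x(d := x d - 1/2)) else (0::real)))" .
qed

section \<open>Adjoints\<close>

definition unitv :: "'i set \<Rightarrow> 'i \<Rightarrow> 'i \<Rightarrow> real" where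
  "unitv I j = (\<lambda>k\<in>I. if k = j then 1 else 0)"

lemma unitv_rvec: "unitv I j \<in> rvec I"
  by (simp add: unitv_def rvec_def)

lemma ip_unitv:
  assumes "finite I" "j \<in> I"
  shows "ip I (unitv I j) u = u j"
proof -
  have "ip I (unitv I j) u = (\<Sum>k\<in>I. if k = j then u k else 0)"
    unfolding ip_def by (rule sum.cong) (auto simp: unitv_def)
  then show ?thesis using assms by simp
qed

lemma rvec_eqI: "u \<in> rvec I \<Longrightarrow> v \<in> rvec I \<Longrightarrow> (\<And>i. i \<in> I \<Longrightarrow> u i = v i) \<Longrightarrow> u = v"
  unfolding rvec_def by (rule PiE_ext) auto

lemma adj_eqI:
  assumes "finite I" "u \<in> rvec I" "\<And>x. x \<in> rvec I \<Longrightarrow> ip J (L x) y = ip I x u"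
  shows "adj I J L y = u"
  unfolding adj_def
proof (rule the_equality)
  fix v assume v: "v \<in> rvec I \<and> (\<forall>x\<in>rvec I. ip J (L x) y = ip I x v)"
  show "v = u"
  proof (rule rvec_eqI)
    fix i assume i: "i \<in> I"
    have "ip I (unitv I i) v = ip I (unitv I i) u"
      using v assms(3) unitv_rvec by metis
    then show "v i = u i" using ip_unitv[OF assms(1) i] by simp
  qed (use v assms in auto)
qed (use assms in auto)

text \<open>If the components of \<open>L\<close> are linear forms, the transposed coefficient matrix is the adjoint. So the
  description in the definition of \<open>adj\<close> is satisfied, and adjoints can be handled through the
  defining identity alone.\<close>
lemma adj_props:
  assumes "finite I" "\<And>j. j \<in> J \<Longrightarrow> lin_form I (\<lambda>x. L x j)"
  shows "adj I J L y \<in> rvec I" and "ip J (L x) y = ip I x (adj I J L y)"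
proof -
  have "\<forall>j\<in>J. \<exists>w. \<forall>x. L x j = (\<Sum>i\<in>I. w i * x i)"
    using assms(2) unfolding lin_form_def by auto
  then obtain W where W: "\<And>j x. j \<in> J \<Longrightarrow> L x j = (\<Sum>i\<in>I. W j i * x i)" by metis
  define u where "u = (\<lambda>i\<in>I. \<Sum>j\<in>J. W j i * y j)"
  have u: "ip J (L x) y = ip I x u" for x
  proof -
    have "ip J (L x) y = (\<Sum>j\<in>J. \<Sum>i\<in>I. x i * (W j i * y j))"
      unfolding ip_def by (rule sum.cong) (simp_all add: W sum_distrib_left sum_distrib_right mult_ac)
    also have "\<dots> = ip I x u"
      by (subst sum.swap) (simp add: ip_def u_def sum_distrib_left)
    finally show ?thesis .
  qed
  have "adj I J L y = u"
    by (rule adj_eqI) (use assms(1) u in \<open>auto simp: u_def rvec_def\<close>)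
  then show "adj I J L y \<in> rvec I" "ip J (L x) y = ip I x (adj I J L y)"
    using u by (auto simp: u_def rvec_def)
qed

lemma Aop_lin:
  assumes "p \<in> Stag D n" shows "lin_form (Gc D n) (\<lambda>\<phi>. Aop D n \<phi> p)"
proof -
  obtain d i where p: "p = (d, i)" "d \<le> D" "i \<in> Gs D n d"
    using assms by (auto simp: Stag_def)
  have "lin_form (Gc D n) (\<lambda>\<phi>. 1 / hstep n d * (\<phi> (i(d := i d + 1/2)) - \<phi> (i(d := i d - 1/2))))"
    by (intro lin_form_cmult lin_form_diff lin_form_coord finite_grids Gs_shift p)
  then show ?thesis using assms p by (simp add: Aop_def)
qed

lemma LT_lin:
  assumes "i \<in> Gs D n 0" shows "lin_form (Gc D n) (\<lambda>y. LT D n y i)"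
proof -
  have "lin_form (Gc D n) (\<lambda>y. 1/2 * (y (i(0 := i 0 - 1/2)) + y (i(0 := i 0 + 1/2))))"
    by (intro lin_form_cmult lin_form_add lin_form_coord finite_grids Gs_shift assms) auto
  then show ?thesis using assms by (simp add: LT_def)
qed

lemma LX_lin:
  assumes "i \<in> Gs D n d" "d \<le> D" shows "lin_form (Gc D n) (\<lambda>y. LX D n d y i)"
proof -
  have "lin_form (Gc D n) (\<lambda>y. 1/2 * (y (i(d := i d - 1/2)) + y (i(d := i d + 1/2))))"
    by (intro lin_form_cmult lin_form_add lin_form_coord finite_grids Gs_shift assms)
  then show ?thesis using assms by (simp add: LX_def)
qed

lemma LX_adjoint_explicit:
  assumes "d \<le> D" "x \<in> Gc D n"
  shows "adj (Gc D n) (Gs D n d) (LX D n d) w x =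
     1/2 * ((if 1 \<le> x d then w (x(d := x d - 1/2)) else 0) +
            (if x d \<le> real (n d) - 1 then w (x(d := x d + 1/2)) else 0))"
proof -
  define u where "u = (\<lambda>x\<in>Gc D n. 1/2 * ((if 1 \<le> x d then w (x(d := x d - 1/2)) else 0) +
            (if x d \<le> real (n d) - 1 then w (x(d := x d + 1/2)) else 0)))"
  have "ip (Gs D n d) (LX D n d y) w = ip (Gc D n) y u" for y
  proof -
    have "ip (Gs D n d) (LX D n d y) w =
      1/2 * ((\<Sum>j\<in>Gs D n d. y (j(d := j d - 1/2)) * w j) + (\<Sum>j\<in>Gs D n d. y (j(d := j d + 1/2)) * w j))"
      by (simp add: ip_def LX_def sum_distrib_left sum.distrib algebra_simps add_divide_distrib sum_divide_distrib)
    also have "\<dots> = ip (Gc D n) y u"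
      unfolding sum_shift[OF assms(1)]
      by (simp add: ip_def u_def sum_distrib_left sum.distrib algebra_simps add_divide_distrib sum_divide_distrib)
    finally show ?thesis .
  qed
  then have "adj (Gc D n) (Gs D n d) (LX D n d) w = u"
    by (intro adj_eqI) (auto simp: finite_grids u_def rvec_def)
  then show ?thesis using assms(2) by (simp add: u_def)
qed

text \<open>This links the two formulations. \<open>\<L>\<^sub>T\<close> and the adjoint of \<open>\<L>\<^sub>X\<close> both average two neighbours,
  so their composition averages the four staggered points around a node, and these are the points
  picked by \<open>\<F>\<^sup>d\<^sub>1, \<dots>, \<F>\<^sup>d\<^sub>4\<close>. The zeros that pad \<open>\<F>\<close> at the boundary are the terms missing from the
  adjoint there.\<close>
lemma LT_LX_adjoint:
  assumes "1 \<le> d" "d \<le> D" "i \<in> Gs D n 0"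
  shows "LT D n (adj (Gc D n) (Gs D n d) (LX D n d) w) i = 1/4 * (\<Sum>k=1..4. Fpart D n d k w i)"
proof -
  have s: "i(0 := i 0 - 1/2) \<in> Gc D n" "i(0 := i 0 + 1/2) \<in> Gc D n"
    using Gs_shift[OF assms(3)] by auto
  have "{1..4::nat} = {1,2,3,4}" by auto
  then show ?thesis
    using assms(1,3)
    by (simp add: LT_def LX_adjoint_explicit[OF assms(2) s(1)] LX_adjoint_explicit[OF assms(2) s(2)] Fpart_def add_divide_distrib)
qed

lemma Fpart_index:
  assumes "i \<in> Gs D n 0" "1 \<le> d" "d \<le> D"
  shows "1 \<le> i d \<Longrightarrow> i(0 := i 0 - 1/2, d := i d - 1/2) \<in> Gs D n d"
    "i d \<le> real (n d) - 1 \<Longrightarrow> i(0 := i 0 - 1/2, d := i d + 1/2) \<in> Gs D n d"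
    "1 \<le> i d \<Longrightarrow> i(0 := i 0 + 1/2, d := i d - 1/2) \<in> Gs D n d"
    "i d \<le> real (n d) - 1 \<Longrightarrow> i(0 := i 0 + 1/2, d := i d + 1/2) \<in> Gs D n d"
proof -
  have s: "i(0 := i 0 - 1/2) \<in> Gc D n" "i(0 := i 0 + 1/2) \<in> Gc D n"
    using Gs_shift[OF assms(1)] by auto
  show "1 \<le> i d \<Longrightarrow> i(0 := i 0 - 1/2, d := i d - 1/2) \<in> Gs D n d"
    "i d \<le> real (n d) - 1 \<Longrightarrow> i(0 := i 0 - 1/2, d := i d + 1/2) \<in> Gs D n d"
    "1 \<le> i d \<Longrightarrow> i(0 := i 0 + 1/2, d := i d - 1/2) \<in> Gs D n d"
    "i d \<le> real (n d) - 1 \<Longrightarrow> i(0 := i 0 + 1/2, d := i d + 1/2) \<in> Gs D n d"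
    using Gc_shift[OF s(1) assms(3)] Gc_shift[OF s(2) assms(3)] assms(2) by auto
qed

lemma Fpart_mult: "Fpart D n d k (\<lambda>j. v j * w j) i = Fpart D n d k v i * Fpart D n d k w i"
  if "i \<in> Gs D n 0"
  using that by (simp add: Fpart_def)

lemma Fpart_cong:
  assumes "i \<in> Gs D n 0" "1 \<le> d" "d \<le> D" "\<And>j. j \<in> Gs D n d \<Longrightarrow> v j = w j"
  shows "Fpart D n d k v i = Fpart D n d k w i"
  using assms(1) Fpart_index[OF assms(1-3)] assms(4) by (simp add: Fpart_def)

lemma Fop_Fpart:
  assumes "i \<in> Gs D n 0" "1 \<le> d" "d \<le> D" "1 \<le> k" "k \<le> 4"
  shows "Fop D n q (4 * (d - 1) + k, i) = Fpart D n d k (\<lambda>j. q (d, j)) i"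
proof -
  have "4 * (d - 1) + k \<le> 4 * D" using assms by auto
  moreover have "(4 * (d - 1) + k - 1) div 4 + 1 = d" "(4 * (d - 1) + k - 1) mod 4 + 1 = k"
  proof -
    obtain d' k' where "d = Suc d'" "k = Suc k'" "k' < 4" 
      using assms by (metis Suc_le_D Suc_le_eq One_nat_def)
    then show "(4 * (d - 1) + k - 1) div 4 + 1 = d" "(4 * (d - 1) + k - 1) mod 4 + 1 = k" by auto
  qed
  ultimately have "Fop D n q (4 * (d - 1) + k, i) = Fpart D n d k (block D n q d) i"
    using assms by (simp add: Fop_def FIdx_def Let_def del: One_nat_def)
  also have "\<dots> = Fpart D n d k (\<lambda>j. q (d, j)) i"
    by (rule Fpart_cong) (use assms in \<open>auto simp: block_def\<close>)
  finally show ?thesis .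
qed

lemma Fop_0: "i \<in> Gs D n 0 \<Longrightarrow> Fop D n q (0, i) = q (0, i)"
  by (simp add: Fop_def FIdx_def)

lemma sum_blocks:
  fixes h :: "nat \<Rightarrow> real"
  shows "(\<Sum>m=1..4*D. h m) = (\<Sum>d=1..D. \<Sum>k=1..4. h (4 * (d - 1) + k))"
proof (induction D)
  case (Suc D)
  have "{1..4 * Suc D} = {1..4*D} \<union> {4*D+1..4*D+4}" by auto
  then have "(\<Sum>m=1..4 * Suc D. h m) = (\<Sum>m=1..4*D. h m) + (\<Sum>m=4*D+1..4*D+4. h m)"
    by (simp only:) (rule sum.union_disjoint, auto)
  also have "(\<Sum>m=4*D+1..4*D+4. h m) = (\<Sum>k=1..4. h (4*D + k))"
    using sum.shift_bounds_cl_nat_ivl[of h 1 "4*D" 4] by (simp add: add.commute)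
  finally show ?case using Suc by simp
qed simp

lemma block_number_cases:
  assumes "1 \<le> m" "m \<le> 4 * D"
  obtains d k where "1 \<le> d" "d \<le> D" "1 \<le> k" "k \<le> (4::nat)" "m = 4 * (d - 1) + k"
proof
  show "m = 4 * (((m - 1) div 4 + 1) - 1) + ((m - 1) mod 4 + 1)" using assms by simp
  have "(m - 1) div 4 < D" using assms by (intro less_mult_imp_div_less) auto
  then show "(m - 1) div 4 + 1 \<le> D" by simp
qed auto

lemma Fpart_lin:
  assumes "i \<in> Gs D n 0" "1 \<le> d" "d \<le> D"
  shows "lin_form (Gs D n d) (\<lambda>v. Fpart D n d k v i)"
  using assms(1) Fpart_index[OF assms]
  by (cases "k = 1"; cases "k = 2"; cases "k = 3"; cases "1 \<le> i d"; cases "i d \<le> real (n d) - 1")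
    (simp_all add: Fpart_def lin_form_coord lin_form_zero finite_grids)

lemma lin_form_block:
  assumes "lin_form (Gs D n d) L" "d \<le> D"
  shows "lin_form (Stag D n) (\<lambda>q. L (\<lambda>j. q (d, j)))"
proof -
  obtain w where w: "\<forall>x. L x = (\<Sum>j\<in>Gs D n d. w j * x j)" using assms unfolding lin_form_def by auto
  have "(\<Sum>j\<in>Gs D n d. w j * q (d, j)) = (\<Sum>p\<in>Stag D n. (if fst p = d then w (snd p) else 0) * q p)" for q
  proof -
    have "(\<Sum>j\<in>Gs D n d. w j * q (d, j)) = (\<Sum>p\<in>Pair d ` Gs D n d. w (snd p) * q p)"
      by (subst sum.reindex) (auto simp: inj_on_def)
    also have "\<dots> = (\<Sum>p\<in>Stag D n. (if fst p = d then w (snd p) else 0) * q p)"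
      using assms(2) by (intro sum.mono_neutral_cong_left) (auto simp: finite_grids Stag_def)
    finally show ?thesis .
  qed
  then show ?thesis unfolding lin_form_def using w by auto
qed

lemma Fop_lin:
  assumes "p \<in> FIdx D n" shows "lin_form (Stag D n) (\<lambda>q. Fop D n q p)"
proof -
  obtain m i where p: "p = (m, i)" "m \<le> 4 * D" "i \<in> Gs D n 0" using assms by (auto simp: FIdx_def)
  show ?thesis
  proof (cases "m = 0")
    case True
    then show ?thesis using p
      by (auto simp: Fop_0 Stag_def intro!: lin_form_coord finite_grids(4)[unfolded Stag_def])
  next
    case False
    then obtain d k where dk: "1 \<le> d" "d \<le> D" "1 \<le> k" "k \<le> (4::nat)" "m = 4 * (d - 1) + k"
      using block_number_cases[of m D] p by auto
    show ?thesis unfolding p(1) dk(5) Fop_Fpart[OF p(3) dk(1-4)]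
      by (rule lin_form_block[OF Fpart_lin]) (use p dk in auto)
  qed
qed

lemma Bop_lin:
  assumes "p \<in> BIdx D n" shows "lin_form (FIdx D n) (\<lambda>r. Bop D n r p)"
proof -
  obtain m i where p: "p = (m, i)" "1 \<le> m" "m \<le> 4 * D + 2" "i \<in> Gs D n 0"
    using assms by (auto simp: BIdx_def)
  have c: "lin_form (FIdx D n) (\<lambda>r. r (k, i))" if "k \<le> 4 * D" for k
    using that p by (intro lin_form_coord finite_grids) (auto simp: FIdx_def)
  have "lin_form (FIdx D n) (\<lambda>r. - r (0, i))" "lin_form (FIdx D n) (\<lambda>r. r (0, i))"
    using lin_form_cmult[OF c[of 0], of "-1"] c[of 0] by simp_all
  moreover have "m \<noteq> 1 \<Longrightarrow> m \<noteq> 4 * D + 2 \<Longrightarrow> lin_form (FIdx D n) (\<lambda>r. sqrt 2 / 2 * r (m - 1, i))"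
    using p by (intro lin_form_cmult c) auto
  ultimately show ?thesis
    using assms unfolding p(1)
    by (cases "m = 1"; cases "m = 4 * D + 2") (simp_all add: Bop_def)
qed

lemma adjoint_identities:
  "ip (Stag D n) (Aop D n \<phi>) \<alpha> = ip (Gc D n) \<phi> (adj (Gc D n) (Stag D n) (Aop D n) \<alpha>)"
  "ip (FIdx D n) (Fop D n q) r = ip (Stag D n) q (adj (Stag D n) (FIdx D n) (Fop D n) r)"
  "ip (BIdx D n) (Bop D n r) \<beta> = ip (FIdx D n) r (adj (FIdx D n) (BIdx D n) (Bop D n) \<beta>)"
  "ip (Gs D n 0) (LT D n y) v = ip (Gc D n) y (LT_adj D n v)"
  "d \<le> D \<Longrightarrow> ip (Gs D n d) (LX D n d y) w = ip (Gc D n) y (adj (Gc D n) (Gs D n d) (LX D n d) w)"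
  unfolding LT_adj_def
  by (rule adj_props(2); simp add: finite_grids Aop_lin Fop_lin Bop_lin LT_lin LX_lin)+

section \<open>Complementarity in the second-order cone\<close>

lemma soc_scaled_reflection_square:
  fixes x y :: "'k \<Rightarrow> real"
  shows "(\<Sum>k\<in>K. (b * x k + a * y k)\<^sup>2) =
    b\<^sup>2 * (\<Sum>k\<in>K. (x k)\<^sup>2) + 2 * a * b * (\<Sum>k\<in>K. x k * y k) + a\<^sup>2 * (\<Sum>k\<in>K. (y k)\<^sup>2)"
  by (simp add: power2_sum power_mult_distrib sum.distrib sum_distrib_left algebra_simps)

text \<open>Self-duality of the cone. Expanding \<open>\<Sum>k. (b x\<^sub>k + a y\<^sub>k)\<^sup>2 \<ge> 0\<close> gives the Cauchy-Schwarz bound in the form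
  in which the equality case can be read off, which is the next lemma.\<close>
lemma soc_inner_nonneg:
  fixes x y :: "'k \<Rightarrow> real"
  assumes "finite K" "0 \<le> a" "0 \<le> b" "(\<Sum>k\<in>K. (x k)\<^sup>2) \<le> a\<^sup>2" "(\<Sum>k\<in>K. (y k)\<^sup>2) \<le> b\<^sup>2"
  shows "0 \<le> a * b + (\<Sum>k\<in>K. x k * y k)"
proof (cases "a * b = 0")
  case True
  then have "(\<Sum>k\<in>K. (x k)\<^sup>2) \<le> 0 \<or> (\<Sum>k\<in>K. (y k)\<^sup>2) \<le> 0" using assms by auto
  then have "(\<Sum>k\<in>K. (x k)\<^sup>2) = 0 \<or> (\<Sum>k\<in>K. (y k)\<^sup>2) = 0"
    by (meson antisym sum_nonneg zero_le_power2)
  then have "(\<forall>k\<in>K. x k = 0) \<or> (\<forall>k\<in>K. y k = 0)"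
    using assms(1) by (simp add: sum_nonneg_eq_0_iff)
  then show ?thesis using True by auto
next
  case False
  have "0 \<le> (\<Sum>k\<in>K. (b * x k + a * y k)\<^sup>2)" by (simp add: sum_nonneg)
  also have "\<dots> \<le> b\<^sup>2 * a\<^sup>2 + 2 * a * b * (\<Sum>k\<in>K. x k * y k) + a\<^sup>2 * b\<^sup>2"
    unfolding soc_scaled_reflection_square using assms by (intro add_mono mult_left_mono) auto
  also have "\<dots> = (2 * (a * b)) * (a * b + (\<Sum>k\<in>K. x k * y k))"
    by (simp add: power2_eq_square algebra_simps)
  finally have "0 \<le> (2 * (a * b)) * (a * b + (\<Sum>k\<in>K. x k * y k))" .
  moreover have "0 < 2 * (a * b)" using False assms(2,3) by (simp add: less_le)
  ultimately show ?thesis by (metis zero_le_mult_iff not_less)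
qed

text \<open>Orthogonality makes \<open>\<Sum>k. (b x\<^sub>k + a y\<^sub>k)\<^sup>2\<close> a sum of two nonpositive quantities. Hence all its terms vanish:
  \<open>(b; y)\<close> is proportional to \<open>(a; x)\<close> reflected in its axis.\<close>
lemma soc_complementary:
  fixes x y :: "'k \<Rightarrow> real"
  assumes "finite K" "(\<Sum>k\<in>K. (x k)\<^sup>2) \<le> a\<^sup>2" "(\<Sum>k\<in>K. (y k)\<^sup>2) \<le> b\<^sup>2"
    and "a * b + (\<Sum>k\<in>K. x k * y k) = 0"
  shows "\<And>k. k \<in> K \<Longrightarrow> b * x k = - (a * y k)" "b * (a\<^sup>2 - (\<Sum>k\<in>K. (x k)\<^sup>2)) = 0"
proof -
  let ?x = "\<Sum>k\<in>K. (x k)\<^sup>2" and ?y = "\<Sum>k\<in>K. (y k)\<^sup>2"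
  have "(\<Sum>k\<in>K. x k * y k) = - (a * b)" using assms(4) by simp
  then have e: "(\<Sum>k\<in>K. (b * x k + a * y k)\<^sup>2) = b\<^sup>2 * (?x - a\<^sup>2) + a\<^sup>2 * (?y - b\<^sup>2)"
    unfolding soc_scaled_reflection_square by (simp add: power2_eq_square algebra_simps)
  have n: "b\<^sup>2 * (?x - a\<^sup>2) \<le> 0" "a\<^sup>2 * (?y - b\<^sup>2) \<le> 0"
    using assms(2,3) by (simp_all add: mult_le_0_iff)
  have p: "0 \<le> (\<Sum>k\<in>K. (b * x k + a * y k)\<^sup>2)" by (simp add: sum_nonneg)
  have "(\<Sum>k\<in>K. (b * x k + a * y k)\<^sup>2) = 0" using e n p by linarith
  then have "\<forall>k\<in>K. (b * x k + a * y k)\<^sup>2 = 0"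
    using assms(1) by (simp add: sum_nonneg_eq_0_iff)
  then show "b * x k = - (a * y k)" if "k \<in> K" for k
    using that by (simp add: eq_neg_iff_add_eq_0)
  have "b\<^sup>2 * (?x - a\<^sup>2) = 0" using e n p by linarith
  then show "b * (a\<^sup>2 - ?x) = 0" by auto
qed

section \<open>The cone constraint and the multiplier at a node\<close>

lemma sum_BIdx:
  "(\<Sum>p\<in>BIdx D n. h p) = (\<Sum>i\<in>Gs D n 0. h (1, i) + (\<Sum>k=1..4*D+1. h (k + 1, i)))"
  for h :: "_ \<Rightarrow> real"
proof -
  have "(\<Sum>p\<in>BIdx D n. h p) = (\<Sum>i\<in>Gs D n 0. \<Sum>m=1..4*D+2. h (m, i))"
    unfolding BIdx_def by (simp add: sum.cartesian_product' sum.swap[of _ "Gs D n 0"])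
  moreover have "(\<Sum>m=1..4*D+2. h (m, i)) = h (1, i) + (\<Sum>k=1..4*D+1. h (k + 1, i))" for i
    using sum.atLeast_Suc_atMost[of 1 "4*D+2" "\<lambda>m. h (m, i)"]
      sum.shift_bounds_cl_Suc_ivl[of "\<lambda>m. h (m, i)" 1 "4*D+1"] by simp
  ultimately show ?thesis by (simp only:)
qed

lemma sum_last: fixes D :: nat shows "(\<Sum>k=1..4*D+1. h k) = (\<Sum>k=1..4*D. h k) + (h (4*D+1) :: real)"
  by simp

lemma Qcone_iff:
  "\<beta> \<in> Qcone D n \<longleftrightarrow> \<beta> \<in> rvec (BIdx D n) \<and>
    (\<forall>i\<in>Gs D n 0. 0 \<le> \<beta> (1, i) \<and> (\<Sum>k=1..4*D+1. (\<beta> (k + 1, i))\<^sup>2) \<le> (\<beta> (1, i))\<^sup>2)"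
proof -
  have "(\<lambda>k\<in>{0..4*D+1}. \<beta> (k + 1, i)) \<in> Ksoc D \<longleftrightarrow>
    0 \<le> \<beta> (1, i) \<and> (\<Sum>k=1..4*D+1. (\<beta> (k + 1, i))\<^sup>2) \<le> (\<beta> (1, i))\<^sup>2" for i
  proof -
    have "(\<lambda>k\<in>{0..4*D+1}. \<beta> (k + 1, i)) \<in> Ksoc D \<longleftrightarrow>
        sqrt (\<Sum>k=1..4*D+1. (\<beta> (k + 1, i))\<^sup>2) \<le> \<beta> (1, i)"
      by (simp add: Ksoc_def rvec_def L2_set_def del: sum.cl_ivl_Suc cong: sum.cong_simp)
    also have "\<dots> \<longleftrightarrow> 0 \<le> \<beta> (1, i) \<and> (\<Sum>k=1..4*D+1. (\<beta> (k + 1, i))\<^sup>2) \<le> (\<beta> (1, i))\<^sup>2"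
    proof
      assume *: "sqrt (\<Sum>k=1..4*D+1. (\<beta> (k + 1, i))\<^sup>2) \<le> \<beta> (1, i)"
      have "0 \<le> sqrt (\<Sum>k=1..4*D+1. (\<beta> (k + 1, i))\<^sup>2)" by (intro real_sqrt_ge_zero sum_nonneg) auto
      then show "0 \<le> \<beta> (1, i) \<and> (\<Sum>k=1..4*D+1. (\<beta> (k + 1, i))\<^sup>2) \<le> (\<beta> (1, i))\<^sup>2"
        using * by (intro conjI sqrt_le_D) linarith+
    qed (auto intro: real_le_lsqrt)
    finally show ?thesis .
  qed
  then show ?thesis by (auto simp: Qcone_def)
qed

lemma slack_values:
  assumes "\<forall>p\<in>BIdx D n. z p = Bop D n (Fop D n q) p + dvec D n p" "i \<in> Gs D n 0"
  shows "z (1, i) = 1 - q (0, i)" "z (4*D+2, i) = 1 + q (0, i)"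
    "\<And>m. m \<in> {1..4*D} \<Longrightarrow> z (m + 1, i) = sqrt 2 / 2 * Fop D n q (m, i)"
proof -
  have "(1, i) \<in> BIdx D n" "(4*D+2, i) \<in> BIdx D n" "\<And>m. m \<in> {1..4*D} \<Longrightarrow> (m + 1, i) \<in> BIdx D n"
    using assms(2) by (auto simp: BIdx_def)
  then show "z (1, i) = 1 - q (0, i)" "z (4*D+2, i) = 1 + q (0, i)"
    "\<And>m. m \<in> {1..4*D} \<Longrightarrow> z (m + 1, i) = sqrt 2 / 2 * Fop D n q (m, i)"
    using assms Fop_0[OF assms(2), of q] by (auto simp: Bop_def dvec_def)
qed

text \<open>Each \<open>\<F>\<^sup>d\<^sub>k\<close> only relocates entries and hence commutes with componentwise products.\<close>
lemma sum_Fop_products: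
  assumes "i \<in> Gs D n 0"
  shows "(\<Sum>m=1..4*D. Fop D n v (m, i) * Fop D n q (m, i)) =
    (\<Sum>d=1..D. 4 * LT D n (adj (Gc D n) (Gs D n d) (LX D n d) (\<lambda>j. v (d, j) * q (d, j))) i)"
  unfolding sum_blocks
proof (rule sum.cong)
  fix d assume d: "d \<in> {1..D}"
  then have "(\<Sum>k=1..4. Fop D n v (4 * (d - 1) + k, i) * Fop D n q (4 * (d - 1) + k, i)) =
      (\<Sum>k=1..4. Fpart D n d k (\<lambda>j. v (d, j) * q (d, j)) i)"
    using assms by (intro sum.cong) (auto simp: Fop_Fpart Fpart_mult simp del: One_nat_def)
  then show "(\<Sum>k=1..4. Fop D n v (4 * (d - 1) + k, i) * Fop D n q (4 * (d - 1) + k, i)) =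
      4 * LT D n (adj (Gc D n) (Gs D n d) (LX D n d) (\<lambda>j. v (d, j) * q (d, j))) i"
    using d LT_LX_adjoint[of d D i n "\<lambda>j. v (d, j) * q (d, j)"] assms by simp
qed simp

lemma LX_adjoint_cong:
  assumes "d \<le> D" "\<And>j. j \<in> Gs D n d \<Longrightarrow> v j = w j"
  shows "adj (Gc D n) (Gs D n d) (LX D n d) v = adj (Gc D n) (Gs D n d) (LX D n d) w"
  unfolding adj_def ip_def using assms by (simp cong: sum.cong)

lemma constr_Fop:
  assumes "i \<in> Gs D n 0"
  shows "constr D n q i = q (0, i) + 1/8 * (\<Sum>m=1..4*D. (Fop D n q (m, i))\<^sup>2)"
proof -
  let ?w = "\<lambda>p\<in>StagX D n. (q p)\<^sup>2"
  have s: "i(0 := i 0 - 1/2) \<in> Gc D n" "i(0 := i 0 + 1/2) \<in> Gc D n"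
    using Gs_shift[OF assms] by auto
  have "LT D n (LX_adj D n ?w) i =
      (\<Sum>d=1..D. LT D n (adj (Gc D n) (Gs D n d) (LX D n d) (block D n ?w d)) i)"
    using assms s by (simp add: LT_def LX_adj_def sum.distrib sum_divide_distrib add_divide_distrib)
  also have "\<dots> = (\<Sum>d=1..D. LT D n (adj (Gc D n) (Gs D n d) (LX D n d) (\<lambda>j. q (d, j) * q (d, j))) i)"
  proof (rule sum.cong)
    fix d assume "d \<in> {1..D}"
    then show "LT D n (adj (Gc D n) (Gs D n d) (LX D n d) (block D n ?w d)) i =
       LT D n (adj (Gc D n) (Gs D n d) (LX D n d) (\<lambda>j. q (d, j) * q (d, j))) i"
      by (subst LX_adjoint_cong[of d D n "block D n ?w d" "\<lambda>j. q (d, j) * q (d, j)"])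
        (auto simp: block_def StagX_def power2_eq_square)
  qed simp
  finally show ?thesis
    using sum_Fop_products[OF assms, of q q] assms
    by (simp add: constr_def power2_eq_square sum_distrib_left[symmetric])
qed

text \<open>The first component \<open>1 - q\<^sub>0\<close> and the last one \<open>1 + q\<^sub>0\<close> contribute \<open>(1 - q\<^sub>0)\<^sup>2 - (1 + q\<^sub>0)\<^sup>2 = -4 q\<^sub>0\<close>; the
  others, with their factor \<open>1/\<surd>2\<close>, contribute \<open>-1/2\<close> times the sum of the squares of the space entries
  of \<open>\<F> q\<close>. So the Lorentz form of the slack is a multiple of
  the quadratic constraint, which is what makes the two problems equivalent.\<close>
lemma slack_tail:
  assumes "\<forall>p\<in>BIdx D n. z p = Bop D n (Fop D n q) p + dvec D n p" "i \<in> Gs D n 0"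
  shows "(z (1, i))\<^sup>2 - (\<Sum>k=1..4*D+1. (z (k + 1, i))\<^sup>2) = - 4 * constr D n q i"
proof -
  have a: "(\<Sum>k=1..4*D. (z (k + 1, i))\<^sup>2) = 1/2 * (\<Sum>m=1..4*D. (Fop D n q (m, i))\<^sup>2)"
    unfolding sum_distrib_left
    by (rule sum.cong) (simp_all only: slack_values(3)[OF assms], simp_all add: power_mult_distrib power_divide)
  have b: "z (4*D+1+1, i) = 1 + q (0, i)" using slack_values(2)[OF assms] by (simp add: eval_nat_numeral)
  have c: "(z (1, i))\<^sup>2 = (1 - q (0, i))\<^sup>2" by (simp only: slack_values(1)[OF assms])
  show ?thesis
    unfolding sum_last a b c constr_Fop[OF assms(2)]
    by (simp add: power2_eq_square algebra_simps)
qed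

lemma slack_in_cone_iff:
  assumes "\<forall>p\<in>BIdx D n. z p = Bop D n (Fop D n q) p + dvec D n p" "z \<in> rvec (BIdx D n)"
  shows "z \<in> Qcone D n \<longleftrightarrow> (\<forall>i\<in>Gs D n 0. constr D n q i \<le> 0)"
proof -
  have "0 \<le> z (1, i) \<and> (\<Sum>k=1..4*D+1. (z (k + 1, i))\<^sup>2) \<le> (z (1, i))\<^sup>2 \<longleftrightarrow> constr D n q i \<le> 0"
    if i: "i \<in> Gs D n 0" for i
  proof -
    have "q (0, i) \<le> constr D n q i"
      using constr_Fop[OF i, of q] by (simp add: sum_nonneg)
    then show ?thesis
      using slack_tail[OF assms(1) i] slack_values(1)[OF assms(1) i] by (intro iffI conjI) linarith+
  qed
  then have "(\<forall>i\<in>Gs D n 0. 0 \<le> z (1, i) \<and> (\<Sum>k=1..4*D+1. (z (k + 1, i))\<^sup>2) \<le> (z (1, i))\<^sup>2)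
    \<longleftrightarrow> (\<forall>i\<in>Gs D n 0. constr D n q i \<le> 0)" by (rule ball_cong[OF refl])
  then show ?thesis by (simp only: Qcone_iff assms(2) simp_thms)
qed

text \<open>Pairing \<open>\<alpha> = -\<F>\<^sup>* \<B>\<^sup>* \<beta>\<close> with a test vector moves both operators to the test side, so that their adjoints
  need not be computed.\<close>
lemma multiplier_weak_form:
  assumes "\<forall>p\<in>Stag D n. \<alpha> p + adj (Stag D n) (FIdx D n) (Fop D n)
                              (adj (FIdx D n) (BIdx D n) (Bop D n) \<beta>) p = 0"
  shows "ip (Stag D n) v \<alpha> = (\<Sum>i\<in>Gs D n 0. v (0, i) * (\<beta> (1, i) - \<beta> (4*D+2, i))
     - sqrt 2 / 2 * (\<Sum>m=1..4*D. Fop D n v (m, i) * \<beta> (m + 1, i)))"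
proof -
  let ?b = "adj (FIdx D n) (BIdx D n) (Bop D n) \<beta>"
  have "v p * \<alpha> p = - (v p * adj (Stag D n) (FIdx D n) (Fop D n) ?b p)" if "p \<in> Stag D n" for p
  proof -
    have "\<alpha> p = - adj (Stag D n) (FIdx D n) (Fop D n) ?b p"
      using assms that by (auto simp: eq_neg_iff_add_eq_0)
    then show ?thesis by simp
  qed
  then have "ip (Stag D n) v \<alpha> = - ip (Stag D n) v (adj (Stag D n) (FIdx D n) (Fop D n) ?b)"
    unfolding ip_def sum_negf[symmetric] by (intro sum.cong) auto
  also have "\<dots> = - ip (BIdx D n) (Bop D n (Fop D n v)) \<beta>"
    by (simp only: adjoint_identities)
  also have "\<dots> = - (\<Sum>i\<in>Gs D n 0. - v (0, i) * \<beta> (1, i) + v (0, i) * \<beta> (4*D+2, i) +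
     (\<Sum>m=1..4*D. sqrt 2 / 2 * (Fop D n v (m, i) * \<beta> (m + 1, i))))"
    unfolding ip_def sum_BIdx sum_last
  proof (intro arg_cong[of _ _ uminus] sum.cong refl)
    fix i assume i: "i \<in> Gs D n 0"
    have "(\<Sum>k=1..4*D. Bop D n (Fop D n v) (k + 1, i) * \<beta> (k + 1, i)) =
       (\<Sum>m=1..4*D. sqrt 2 / 2 * (Fop D n v (m, i) * \<beta> (m + 1, i)))"
      by (rule sum.cong) (use i in \<open>auto simp: Bop_def BIdx_def\<close>)
    moreover have "Bop D n (Fop D n v) (1, i) = - v (0, i)"
      "Bop D n (Fop D n v) (4*D+2, i) = v (0, i)"
      using i by (simp_all add: Bop_def BIdx_def Fop_0)
    moreover have "4*D+1+1 = 4*D+2" by simp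
    ultimately show "Bop D n (Fop D n v) (1, i) * \<beta> (1, i) +
          ((\<Sum>k=1..4*D. Bop D n (Fop D n v) (k + 1, i) * \<beta> (k + 1, i)) +
           Bop D n (Fop D n v) (4*D+1+1, i) * \<beta> (4*D+1+1, i)) =
         - v (0, i) * \<beta> (1, i) + v (0, i) * \<beta> (4*D+2, i) +
          (\<Sum>m=1..4*D. sqrt 2 / 2 * (Fop D n v (m, i) * \<beta> (m + 1, i)))"
      by (simp only:)
  qed
  also have "\<dots> = (\<Sum>i\<in>Gs D n 0. v (0, i) * (\<beta> (1, i) - \<beta> (4*D+2, i))
     - sqrt 2 / 2 * (\<Sum>m=1..4*D. Fop D n v (m, i) * \<beta> (m + 1, i)))"
    unfolding sum_negf[symmetric] sum_distrib_left[symmetric]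
    by (rule sum.cong) (simp_all add: algebra_simps)
  finally show ?thesis .
qed

text \<open>When \<open>\<beta>\<close> is at each node the multiple \<open>s\<close> of the reflected slack, the pairing of \<open>v\<close> with \<open>\<alpha>\<close> is \<open>2 s\<close> times
  the derivative of the quadratic constraints at \<open>q\<close> in the direction \<open>v\<close>. Thus \<open>\<alpha>\<close> encodes multipliers
  \<open>2 s\<close> of the quadratic constraints. Both halves of the main result use this identity: to read the
  multipliers off from \<open>\<beta>\<close>, and to build \<open>\<beta>\<close> from them.\<close>
lemma reflected_multiplier_weak_form:
  assumes z: "\<forall>p\<in>BIdx D n. z p = Bop D n (Fop D n q) p + dvec D n p"
    and \<alpha>: "\<forall>p\<in>Stag D n. \<alpha> p + adj (Stag D n) (FIdx D n) (Fop D n)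
                              (adj (FIdx D n) (BIdx D n) (Bop D n) \<beta>) p = 0"
    and \<beta>: "\<forall>i\<in>Gs D n 0. \<beta> (1, i) = s i * z (1, i)"
      "\<forall>i\<in>Gs D n 0. \<forall>k\<in>{1..4*D+1}. \<beta> (k + 1, i) = - (s i * z (k + 1, i))"
  shows "ip (Stag D n) v \<alpha> = (\<Sum>i\<in>Gs D n 0. 2 * s i *
     (v (0, i) + 1/4 * (\<Sum>m=1..4*D. Fop D n v (m, i) * Fop D n q (m, i))))"
proof (subst multiplier_weak_form[OF \<alpha>], rule sum.cong)
  fix i assume i: "i \<in> Gs D n 0"
  have e1: "\<beta> (4*D+2, i) = - (s i * (1 + q (0, i)))"
    using bspec[OF bspec[OF \<beta>(2) i], of "4*D+1"] slack_values(2)[OF z i] by (simp add: eval_nat_numeral)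
  have e2: "\<beta> (1, i) = s i * (1 - q (0, i))" using bspec[OF \<beta>(1) i] slack_values(1)[OF z i] by simp
  have e3: "(\<Sum>m=1..4*D. Fop D n v (m, i) * \<beta> (m + 1, i)) =
     (\<Sum>m=1..4*D. - (s i * sqrt 2 / 2) * (Fop D n v (m, i) * Fop D n q (m, i)))"
  proof (rule sum.cong)
    fix m assume m: "m \<in> {1..4*D}"
    then have "\<beta> (m + 1, i) = - (s i * (sqrt 2 / 2 * Fop D n q (m, i)))"
      using bspec[OF bspec[OF \<beta>(2) i], of m] slack_values(3)[OF z i m] by simp
    then show "Fop D n v (m, i) * \<beta> (m + 1, i) = - (s i * sqrt 2 / 2) * (Fop D n v (m, i) * Fop D n q (m, i))"
      by simp
  qed simp
  have e4: "sqrt 2 / 2 * (- (s i * sqrt 2 / 2) * S) = - (s i * S / 2)" for S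
  proof -
    have "sqrt 2 / 2 * (- (s i * sqrt 2 / 2) * S) = - (s i * S) * (sqrt 2)\<^sup>2 / 4"
      unfolding power2_eq_square by (simp del: real_sqrt_mult_self)
    then show ?thesis by simp
  qed
  show "v (0, i) * (\<beta> (1, i) - \<beta> (4*D+2, i))
     - sqrt 2 / 2 * (\<Sum>m=1..4*D. Fop D n v (m, i) * \<beta> (m + 1, i)) = 2 * s i *
     (v (0, i) + 1/4 * (\<Sum>m=1..4*D. Fop D n v (m, i) * Fop D n q (m, i)))"
    unfolding e1 e2 e3 sum_distrib_left[symmetric] e4 by (simp add: algebra_simps)
qed simp

text \<open>The pairings that turn the preceding identity into formulas for single entries of \<open>\<alpha>\<close>.\<close>
lemma Fop_unit:
  assumes "i \<in> Gs D n 0"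
  shows "(\<Sum>m=1..4*D. Fop D n (unitv (Stag D n) (0, j)) (m, i) * Fop D n q (m, i)) = 0"
    and "1 \<le> d \<Longrightarrow> d \<le> D \<Longrightarrow> (\<Sum>m=1..4*D. Fop D n (unitv (Stag D n) (d, j)) (m, i) * Fop D n q (m, i)) =
      4 * LT D n (adj (Gc D n) (Gs D n d) (LX D n d) (\<lambda>k. (if k = j then 1 else 0) * q (d, k))) i"
proof -
  have z: "LT D n (adj (Gc D n) (Gs D n e) (LX D n e) (\<lambda>k. unitv (Stag D n) (d, j) (e, k) * q (e, k))) i = 0"
    if "1 \<le> e" "e \<le> D" "e \<noteq> d" for d e
  proof -
    have "adj (Gc D n) (Gs D n e) (LX D n e) (\<lambda>k. unitv (Stag D n) (d, j) (e, k) * q (e, k)) =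
       adj (Gc D n) (Gs D n e) (LX D n e) (\<lambda>k. 0)"
      using that by (intro LX_adjoint_cong) (auto simp: unitv_def Stag_def)
    moreover have "Fpart D n e k (\<lambda>k. 0) i = 0" for k by (simp add: Fpart_def assms)
    ultimately show ?thesis
      using LT_LX_adjoint[OF that(1,2) assms, of "\<lambda>k. 0"] by simp
  qed
  show "(\<Sum>m=1..4*D. Fop D n (unitv (Stag D n) (0, j)) (m, i) * Fop D n q (m, i)) = 0"
    unfolding sum_Fop_products[OF assms] by (rule sum.neutral) (auto simp: z)
  assume d: "1 \<le> d" "d \<le> D"
  have "(\<Sum>m=1..4*D. Fop D n (unitv (Stag D n) (d, j)) (m, i) * Fop D n q (m, i)) =
    (\<Sum>e=1..D. if e = d then 4 * LT D n (adj (Gc D n) (Gs D n d) (LX D n d) (\<lambda>k. (if k = j then 1 else 0) * q (d, k))) i else 0)"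
    unfolding sum_Fop_products[OF assms]
  proof (rule sum.cong)
    fix e assume e: "e \<in> {1..D}"
    have "adj (Gc D n) (Gs D n d) (LX D n d) (\<lambda>k. unitv (Stag D n) (d, j) (d, k) * q (d, k)) =
       adj (Gc D n) (Gs D n d) (LX D n d) (\<lambda>k. (if k = j then 1 else 0) * q (d, k))"
      using d by (intro LX_adjoint_cong) (auto simp: unitv_def Stag_def)
    then show "4 * LT D n (adj (Gc D n) (Gs D n e) (LX D n e) (\<lambda>k. unitv (Stag D n) (d, j) (e, k) * q (e, k))) i =
       (if e = d then 4 * LT D n (adj (Gc D n) (Gs D n d) (LX D n d) (\<lambda>k. (if k = j then 1 else 0) * q (d, k))) i else 0)"
      using z e by auto
  qed simp
  then show "(\<Sum>m=1..4*D. Fop D n (unitv (Stag D n) (d, j)) (m, i) * Fop D n q (m, i)) =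
      4 * LT D n (adj (Gc D n) (Gs D n d) (LX D n d) (\<lambda>k. (if k = j then 1 else 0) * q (d, k))) i"
    using d by simp
qed

section \<open>From the cone program to the transport problem\<close>

text \<open>The slack \<open>z\<close> is never at the apex, because \<open>1 - q\<^sub>0 \<ge> 1\<close> for feasible \<open>q\<close>. So complementarity at a node
  forces \<open>\<beta> = s (z\<^sub>1; -z')\<close>, where \<open>z'\<close> consists of the other components of \<open>z\<close>, with
  \<open>s = \<beta>\<^sub>1 / z\<^sub>1 \<ge> 0\<close>, and the entries of \<open>\<alpha>\<close> follow by testing the weak form with unit vectors: in the time block they are \<open>2 s\<close>, in a space block the adjoint identities
  turn them into \<open>\<L>\<^sub>X \<L>\<^sub>T\<^sup>* \<alpha>\<^sub>0\<close> times \<open>q\<close>.\<close>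
theorem kkt_soc_imp_kkt_dot:
  assumes sol: "(\<phi>, z, q, \<alpha>, \<beta>) \<in> kkt_soc D n c"
    and \<alpha>0: "\<alpha>0 \<in> rvec (Gs D n 0)" and \<alpha>b: "\<alpha>b \<in> rvec (StagX D n)" and \<alpha>: "\<alpha> = join_blocks D n \<alpha>0 \<alpha>b"
  shows "(\<phi>, q, \<alpha>0, \<alpha>b, (\<lambda>i\<in>Gs D n 0. - \<alpha>0 i)) \<in> kkt_dot D n c"
proof -
  let ?G = "Gs D n 0"
  have z: "\<forall>p\<in>BIdx D n. z p = Bop D n (Fop D n q) p + dvec D n p"
    and cones: "z \<in> Qcone D n" "\<beta> \<in> Qcone D n" and comp: "ip (BIdx D n) z \<beta> = 0"
    and dual: "\<forall>p\<in>Stag D n. \<alpha> p + adj (Stag D n) (FIdx D n) (Fop D n)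
                              (adj (FIdx D n) (BIdx D n) (Bop D n) \<beta>) p = 0"
    and rest: "\<phi> \<in> rvec (Gc D n)" "q \<in> rvec (Stag D n)" "z \<in> rvec (BIdx D n)" "Aop D n \<phi> = q"
      "\<And>i. i \<in> Gc D n \<Longrightarrow> adj (Gc D n) (Stag D n) (Aop D n) \<alpha> i = - c i"
    using sol by (auto simp: kkt_soc_def)
  have feas: "constr D n q i \<le> 0" if "i \<in> ?G" for i
    using slack_in_cone_iff[OF z rest(3)] cones that by blast
  have zc: "0 \<le> z (1, i)" "(\<Sum>k=1..4*D+1. (z (k + 1, i))\<^sup>2) \<le> (z (1, i))\<^sup>2"
    and bc: "0 \<le> \<beta> (1, i)" "(\<Sum>k=1..4*D+1. (\<beta> (k + 1, i))\<^sup>2) \<le> (\<beta> (1, i))\<^sup>2" if "i \<in> ?G" for i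
    using cones that unfolding Qcone_iff by blast+
  define t where "t i = z (1, i) * \<beta> (1, i) + (\<Sum>k=1..4*D+1. z (k + 1, i) * \<beta> (k + 1, i))" for i
  have "t i \<ge> 0" if "i \<in> ?G" for i
    unfolding t_def by (rule soc_inner_nonneg) (use zc bc that in blast)+
  moreover have "(\<Sum>i\<in>?G. t i) = 0"
    using comp unfolding ip_def sum_BIdx t_def .
  ultimately have t0: "t i = 0" if "i \<in> ?G" for i
    using that by (simp add: sum_nonneg_eq_0_iff finite_grids)
  define s where "s i = \<beta> (1, i) / z (1, i)" for i
  have zpos: "z (1, i) > 0" if i: "i \<in> ?G" for i
  proof -
    have "q (0, i) \<le> constr D n q i"
      using constr_Fop[OF i, of q] by (simp add: sum_nonneg)
    then show ?thesis using feas[OF i] slack_values(1)[OF z i] by linarith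
  qed
  have refl1: "\<forall>i\<in>?G. \<beta> (1, i) = s i * z (1, i)"
    using zpos by (force simp: s_def)
  have refl2: "\<forall>i\<in>?G. \<forall>k\<in>{1..4*D+1}. \<beta> (k + 1, i) = - (s i * z (k + 1, i))"
  proof (intro ballI)
    fix i k assume i: "i \<in> ?G" and k: "k \<in> {1..4*D+1}"
    have "\<beta> (1, i) * z (k + 1, i) = - (z (1, i) * \<beta> (k + 1, i))"
      by (rule soc_complementary(1)[OF _ zc(2)[OF i] bc(2)[OF i] t0[OF i, unfolded t_def] k]) simp
    then show "\<beta> (k + 1, i) = - (s i * z (k + 1, i))" using zpos[OF i] by (simp add: s_def field_simps)
  qed
  note weak = reflected_multiplier_weak_form[OF z dual refl1 refl2]
  have a0: "\<alpha>0 j = 2 * s j" if j: "j \<in> ?G" for j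
  proof -
    have jS: "(0, j) \<in> Stag D n" using j by (auto simp: Stag_def)
    have "\<alpha>0 j = \<alpha> (0, j)" using jS by (simp add: \<alpha> join_blocks_def)
    also have "\<dots> = ip (Stag D n) (unitv (Stag D n) (0, j)) \<alpha>"
      by (simp add: ip_unitv finite_grids jS)
    also have "\<dots> = (\<Sum>i\<in>?G. 2 * s i * (unitv (Stag D n) (0, j) (0, i) + 1/4 * 0))"
      unfolding weak by (rule sum.cong)
        (simp_all only: Fop_unit(1))
    also have "\<dots> = (\<Sum>i\<in>?G. if i = j then 2 * s i else 0)"
      by (rule sum.cong) (auto simp: unitv_def Stag_def)
    finally show ?thesis using j by (simp add: finite_grids)
  qed
  have s0: "s i \<ge> 0" if "i \<in> ?G" for i
    using zpos[OF that] bc(1)[OF that] by (simp add: s_def)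
  have slack: "\<alpha>0 i * constr D n q i = 0" if i: "i \<in> ?G" for i
  proof -
    have "\<beta> (1, i) * ((z (1, i))\<^sup>2 - (\<Sum>k=1..4*D+1. (z (k + 1, i))\<^sup>2)) = 0"
      by (rule soc_complementary(2)[OF _ zc(2)[OF i] bc(2)[OF i] t0[OF i, unfolded t_def]]) simp
    then have "\<beta> (1, i) * constr D n q i = 0"
      unfolding slack_tail[OF z i] by simp
    then show ?thesis using a0[OF i] zpos[OF i] by (auto simp: s_def)
  qed
  have flux: "\<alpha>b (d, j) = LX D n d (LT_adj D n \<alpha>0) j * q (d, j)"
    if d: "1 \<le> d" "d \<le> D" and j: "j \<in> Gs D n d" for d j
  proof -
    let ?w = "\<lambda>k. (if k = j then 1 else 0) * q (d, k)"
    let ?y = "adj (Gc D n) (Gs D n d) (LX D n d) ?w"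
    have jS: "(d, j) \<in> Stag D n" using j d by (auto simp: Stag_def)
    have "\<alpha>b (d, j) = \<alpha> (d, j)" using jS d by (simp add: \<alpha> join_blocks_def)
    also have "\<dots> = ip (Stag D n) (unitv (Stag D n) (d, j)) \<alpha>"
      by (simp add: ip_unitv finite_grids jS)
    also have "\<dots> = (\<Sum>i\<in>?G. 2 * s i * (unitv (Stag D n) (d, j) (0, i) + 1/4 * (4 * LT D n ?y i)))"
      unfolding weak by (rule sum.cong)
        (simp_all only: Fop_unit(2)[OF _ d])
    also have "\<dots> = ip ?G (LT D n ?y) \<alpha>0"
      unfolding ip_def by (rule sum.cong) (use d in \<open>auto simp: unitv_def Stag_def a0\<close>)
    also have "\<dots> = ip (Gc D n) (LT_adj D n \<alpha>0) ?y"
      unfolding adjoint_identities by (simp add: ip_def mult.commute)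
    also have "\<dots> = ip (Gs D n d) (LX D n d (LT_adj D n \<alpha>0)) ?w"
      using adjoint_identities(5)[OF d(2)] by simp
    also have "\<dots> = (\<Sum>k\<in>Gs D n d. if k = j then LX D n d (LT_adj D n \<alpha>0) k * q (d, k) else 0)"
      unfolding ip_def by (rule sum.cong) auto
    finally show ?thesis using j by (simp add: finite_grids)
  qed
  have "ip ?G \<alpha>0 (constr D n q) = 0" unfolding ip_def by (rule sum.neutral) (use slack in blast)
  moreover have "0 \<le> \<alpha>0 i" if "i \<in> ?G" for i using a0 s0 that by simp
  moreover have "adj (Gc D n) (Stag D n) (Aop D n) (join_blocks D n \<alpha>0 \<alpha>b) i + c i = 0" if "i \<in> Gc D n" for i
    using rest(5)[OF that] \<alpha> by simp
  moreover have "\<alpha>0 i + (\<lambda>i\<in>?G. - \<alpha>0 i) i = 0" if "i \<in> ?G" for i using that by simp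
  moreover have "(\<lambda>i\<in>?G. - \<alpha>0 i) \<in> rvec ?G" by (simp add: rvec_def)
  ultimately show ?thesis
    unfolding kkt_dot_def mem_Collect_eq prod.case
    using rest(1,2,4) \<alpha>0 \<alpha>b feas flux
    by (intro conjI ballI) (assumption | simp)+
qed

section \<open>Bounds on the sublevel set\<close>

lemma axis_path_bound:
  assumes i: "i \<in> Gc D n" and d: "d \<le> D" and S: "\<And>j. j \<in> Gs D n d \<Longrightarrow> \<bar>Aop D n \<phi> (d, j)\<bar> \<le> S" "0 \<le> S"
  shows "\<bar>\<phi> i - \<phi> (i(d := 0))\<bar> \<le> real (n d) * S"
proof -
  have step: "\<bar>\<phi> (i(d := real m)) - \<phi> (i(d := 0))\<bar> \<le> real m * S" if "m \<le> n d" for m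
    using that
  proof (induction m)
    case (Suc m)
    let ?j = "i(d := real m + 1/2)"
    have "real m + 1/2 \<in> Js n d" unfolding Js_iff using Suc.prems by (intro exI[of _ m]) auto
    then have j: "?j \<in> Gs D n d" using i d unfolding Gc_iff Gs_iff by auto
    then have "Aop D n \<phi> (d, ?j) = real (n d) * (\<phi> (i(d := real (Suc m))) - \<phi> (i(d := real m)))"
      using d by (simp add: Aop_def Stag_def hstep_def add.commute)
    then have "\<bar>\<phi> (i(d := real (Suc m))) - \<phi> (i(d := real m))\<bar> * real (n d) \<le> S"
      using S(1)[OF j] by (simp add: abs_mult mult.commute)
    moreover have "\<bar>\<phi> (i(d := real (Suc m))) - \<phi> (i(d := real m))\<bar> * 1 \<le>
        \<bar>\<phi> (i(d := real (Suc m))) - \<phi> (i(d := real m))\<bar> * real (n d)"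
      using Suc.prems by (intro mult_left_mono) auto
    ultimately have "\<bar>\<phi> (i(d := real (Suc m))) - \<phi> (i(d := real m))\<bar> \<le> S"
      unfolding mult_1_right by (rule order_trans[rotated])
    moreover have "\<bar>\<phi> (i(d := real m)) - \<phi> (i(d := 0))\<bar> \<le> real m * S"
      by (rule Suc.IH) (use Suc.prems in simp)
    moreover have "real (Suc m) * S = real m * S + S" by (simp add: algebra_simps)
    ultimately show ?case by linarith
  qed simp
  have "i d \<in> Jc n d" using i d unfolding Gc_iff by (auto dest: spec[of _ d])
  then obtain m where m: "m \<le> n d" "i d = real m" unfolding Jc_iff by auto
  have "i(d := real m) = i" using m(2) by auto
  then have "\<bar>\<phi> i - \<phi> (i(d := 0))\<bar> \<le> real m * S" using step[OF m(1)] by simp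
  also have "\<dots> \<le> real (n d) * S" using m S by (intro mult_right_mono) auto
  finally show ?thesis .
qed

text \<open>Walk from \<open>i\<close> to its projection along the axes in \<open>T\<close>, one axis after the other. With only the space
  axes this compares the values within one time slice; with all axes it bounds the potential up to a
  constant.\<close>
lemma grid_path_bound:
  assumes i: "i \<in> Gc D n" and T: "T \<subseteq> {0..D}"
    and S: "\<And>d j. d \<in> T \<Longrightarrow> j \<in> Gs D n d \<Longrightarrow> \<bar>Aop D n \<phi> (d, j)\<bar> \<le> S" "0 \<le> S"
  shows "\<bar>\<phi> i - \<phi> (\<lambda>k. if k \<in> T then 0 else i k)\<bar> \<le> real (\<Sum>d\<in>T. n d) * S"
proof -
  have "finite T" using T finite_subset by blast
  then show ?thesis using T S(1)
  proof (induction T rule: finite_induct)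
    case (insert d T)
    let ?i = "\<lambda>k. if k \<in> T then 0 else i k"
    have "0 \<in> Jc n k" for k by (force simp: Jc_iff)
    then have "?i \<in> Gc D n" using i insert.prems unfolding Gc_iff by auto
    then have "\<bar>\<phi> ?i - \<phi> (?i(d := 0))\<bar> \<le> real (n d) * S"
      using insert.prems S(2) by (intro axis_path_bound) auto
    moreover have "?i(d := 0) = (\<lambda>k. if k \<in> insert d T then 0 else i k)" by auto
    ultimately have 1: "\<bar>\<phi> ?i - \<phi> (\<lambda>k. if k \<in> insert d T then 0 else i k)\<bar> \<le> real (n d) * S" by simp
    have 2: "\<bar>\<phi> i - \<phi> ?i\<bar> \<le> real (\<Sum>d\<in>T. n d) * S" using insert by auto
    show ?case using 1 2 insert.hyps by (simp add: distrib_right)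
  qed simp
qed

lemma sum_time_slice:
  fixes g :: "idx \<Rightarrow> real"
  assumes "t \<in> Jc n 0"
  shows "(\<Sum>i\<in>Gc D n. if i 0 = t then g i else 0) = (\<Sum>x\<in>GcX D n. g (x(0 := t)))"
proof -
  have "(\<Sum>i\<in>Gc D n. if i 0 = t then g i else 0) = (\<Sum>i\<in>{i \<in> Gc D n. i 0 = t}. g i)"
    by (rule sum.mono_neutral_cong_right) (auto simp: finite_grids)
  also have "\<dots> = (\<Sum>x\<in>GcX D n. g (x(0 := t)))"
  proof (rule sum.reindex_bij_witness[of _ "\<lambda>x. x(0 := t)" "\<lambda>i. i(0 := undefined)"])
    fix i assume i: "i \<in> {i \<in> Gc D n. i 0 = t}"
    then show "i(0 := undefined) \<in> GcX D n" unfolding Gc_iff GcX_iff mem_Collect_eq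
      by (auto split: if_splits)
    show "(i(0 := undefined))(0 := t) = i" using i by auto
    then show "g ((i(0 := undefined))(0 := t)) = g i" by simp
  next
    fix x assume x: "x \<in> GcX D n"
    then have "x 0 = undefined" unfolding GcX_iff by (auto dest: spec[of _ 0])
    then show "(x(0 := t))(0 := undefined) = x" by auto
    show "x(0 := t) \<in> {i \<in> Gc D n. i 0 = t}"
      using x assms unfolding Gc_iff GcX_iff mem_Collect_eq by (auto split: if_splits)
  qed
  finally show ?thesis .
qed

lemma ip_cvec:
  assumes "n 0 > 0"
  shows "ip (Gc D n) (cvec D n \<rho>0 \<rho>1) \<phi> =
    (\<Sum>x\<in>GcX D n. measure \<rho>0 (cell D n x) * \<phi> (x(0 := 0))) -
    (\<Sum>x\<in>GcX D n. measure \<rho>1 (cell D n x) * \<phi> (x(0 := real (n 0))))"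
proof -
  have t: "0 \<in> Jc n 0" "real (n 0) \<in> Jc n 0" unfolding Jc_iff by auto
  have r: "restrict (x(0 := t)) {Suc 0..D} = x" "restrict x {Suc 0..D} = x" if "x \<in> GcX D n" for x t
    using that unfolding GcX_iff by (intro ext; auto simp: restrict_def split: if_splits)+
  have "ip (Gc D n) (cvec D n \<rho>0 \<rho>1) \<phi> =
      (\<Sum>i\<in>Gc D n. if i 0 = 0 then measure \<rho>0 (cell D n (restrict i {1..D})) * \<phi> i else 0) -
      (\<Sum>i\<in>Gc D n. if i 0 = real (n 0) then measure \<rho>1 (cell D n (restrict i {1..D})) * \<phi> i else 0)"
    unfolding ip_def sum_subtractf[symmetric] by (rule sum.cong) (use assms in \<open>auto simp: cvec_def\<close>)
  also have "\<dots> = (\<Sum>x\<in>GcX D n. measure \<rho>0 (cell D n x) * \<phi> (x(0 := 0))) -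
    (\<Sum>x\<in>GcX D n. measure \<rho>1 (cell D n x) * \<phi> (x(0 := real (n 0))))"
    unfolding sum_time_slice[OF t(1)] sum_time_slice[OF t(2)]
    by (intro arg_cong2[of _ _ _ _ "(-)"] sum.cong) (simp_all add: r)
  finally show ?thesis .
qed

lemma sum_time_differences:
  assumes "n 0 > 0"
  shows "(\<Sum>i\<in>Gs D n 0. Aop D n \<phi> (0, i)) =
    real (n 0) * ((\<Sum>x\<in>GcX D n. \<phi> (x(0 := real (n 0)))) - (\<Sum>x\<in>GcX D n. \<phi> (x(0 := 0))))"
proof -
  have t: "0 \<in> Jc n 0" "real (n 0) \<in> Jc n 0" unfolding Jc_iff by auto
  have up: "(\<Sum>i\<in>Gs D n 0. \<phi> (i(0 := i 0 + 1/2)) * 1) =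
      (\<Sum>x\<in>Gc D n. \<phi> x * (if 1 \<le> x 0 then 1 else 0))"
    and down: "(\<Sum>i\<in>Gs D n 0. \<phi> (i(0 := i 0 - 1/2)) * 1) =
      (\<Sum>x\<in>Gc D n. \<phi> x * (if x 0 \<le> real (n 0) - 1 then 1 else 0))"
    by (rule sum_shift[OF le0])+
  have "(\<Sum>i\<in>Gs D n 0. Aop D n \<phi> (0, i)) = real (n 0) *
      ((\<Sum>i\<in>Gs D n 0. \<phi> (i(0 := i 0 + 1/2)) * 1) - (\<Sum>i\<in>Gs D n 0. \<phi> (i(0 := i 0 - 1/2)) * 1))"
    unfolding sum_subtractf[symmetric] sum_distrib_left
    by (rule sum.cong) (auto simp: Aop_def Stag_def hstep_def)
  also have "(\<Sum>i\<in>Gs D n 0. \<phi> (i(0 := i 0 + 1/2)) * 1) - (\<Sum>i\<in>Gs D n 0. \<phi> (i(0 := i 0 - 1/2)) * 1) =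
     (\<Sum>x\<in>Gc D n. if x 0 = real (n 0) then \<phi> x else 0) - (\<Sum>x\<in>Gc D n. if x 0 = 0 then \<phi> x else 0)"
    unfolding up down sum_subtractf[symmetric]
  proof (rule sum.cong)
    fix x assume "x \<in> Gc D n"
    then have "x 0 \<in> Jc n 0" unfolding Gc_iff by (auto dest: spec[of _ 0])
    then obtain m where m: "m \<le> n 0" "x 0 = real m" unfolding Jc_iff by auto
    have "m = 0 \<or> m = n 0 \<or> 1 \<le> real m \<and> real m \<le> real (n 0) - 1" using m by linarith
    then show "\<phi> x * (if 1 \<le> x 0 then 1 else 0) - \<phi> x * (if x 0 \<le> real (n 0) - 1 then 1 else 0) =
        (if x 0 = real (n 0) then \<phi> x else 0) - (if x 0 = 0 then \<phi> x else 0)"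
      unfolding m(2) using assms by auto
  qed simp
  finally show ?thesis unfolding sum_time_slice[OF t(1)] sum_time_slice[OF t(2)] .
qed

lemma zero_mean_bound:
  fixes w \<psi> :: "'x \<Rightarrow> real"
  assumes "(\<Sum>x\<in>X. w x) = 0" "\<And>x. x \<in> X \<Longrightarrow> \<bar>\<psi> x - k\<bar> \<le> B"
  shows "\<bar>\<Sum>x\<in>X. w x * \<psi> x\<bar> \<le> (\<Sum>x\<in>X. \<bar>w x\<bar>) * B"
proof -
  have "(\<Sum>x\<in>X. w x * \<psi> x) = (\<Sum>x\<in>X. w x * (\<psi> x - k)) + (\<Sum>x\<in>X. w x) * k"
    by (simp add: right_diff_distrib sum_subtractf sum_distrib_right)
  also have "\<bar>\<dots>\<bar> \<le> (\<Sum>x\<in>X. \<bar>w x * (\<psi> x - k)\<bar>)"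
    using assms(1) by (simp add: sum_abs)
  also have "\<dots> \<le> (\<Sum>x\<in>X. \<bar>w x\<bar> * B)"
    using assms(2) by (intro sum_mono) (simp add: abs_mult mult_left_mono)
  finally show ?thesis by (simp add: sum_distrib_right)
qed

text \<open>Consequently the sum of the squares of all space entries of \<open>\<F> q\<close> dominates each \<open>(q\<^sub>d)\<^sub>j\<^sup>2\<close>. Moving forward
  from \<open>j\<close> by half a step in direction \<open>d\<close> always stays on the grid; in time one moves forward or, from
  the final time, backward.\<close>
lemma Fop_covers:
  assumes n: "n 0 > 0" and d: "1 \<le> d" "d \<le> D" and j: "j \<in> Gs D n d"
  obtains m i where "m \<in> {1..4*D}" "i \<in> Gs D n 0" "\<And>q. Fop D n q (m, i) = q (d, j)"
proof -
  let ?x = "j(d := j d + 1/2)"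
  have x: "?x \<in> Gc D n" and jd: "j d \<in> Js n d" using Gs_shift[OF j d(2)] j d unfolding Gs_iff
    by (auto dest: spec[of _ d])
  have ge: "1 \<le> j d + 1/2" using jd unfolding Js_iff by auto
  have x0: "?x 0 = j 0" using d by simp
  have "j 0 \<in> Jc n 0" using j d unfolding Gs_iff by (auto dest: spec[of _ 0])
  then obtain m where m: "m \<le> n 0" "j 0 = real m" unfolding Jc_iff by auto
  show ?thesis
  proof (cases "j 0 \<le> real (n 0) - 1")
    case True
    let ?i = "?x(0 := ?x 0 + 1/2)"
    have i: "?i \<in> Gs D n 0" using Gc_shift(1)[OF x le0] True x0 by simp
    have "?i(0 := ?i 0 - 1/2, d := ?i d - 1/2) = j" using d by auto
    then have "Fop D n q (4 * (d - 1) + 1, ?i) = q (d, j)" for q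
      using i ge d by (subst Fop_Fpart) (auto simp: Fpart_def)
    then show ?thesis using i d by (intro that[of "4 * (d - 1) + 1" ?i]) auto
  next
    case False
    let ?i = "?x(0 := ?x 0 - 1/2)"
    have "real (n 0) < real (m + 1)" using False m by simp
    then have "n 0 < m + 1" by (simp only: of_nat_less_iff)
    then have "1 \<le> j 0" using m n by simp
    then have i: "?i \<in> Gs D n 0" using Gc_shift(2)[OF x le0] x0 by simp
    have "?i(0 := ?i 0 + 1/2, d := ?i d - 1/2) = j" using d by auto
    then have "Fop D n q (4 * (d - 1) + 3, ?i) = q (d, j)" for q
      using i ge d by (subst Fop_Fpart) (auto simp: Fpart_def)
    then show ?thesis using i d by (intro that[of "4 * (d - 1) + 3" ?i]) auto
  qed
qed

text \<open>Positive total mass, equal for both measures, enters here. A suitable flux makes the uniform density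
  feasible, and that density is strictly positive: spreading mass \<open>1\<close> evenly gives the weight
  \<open>a = 1/(n\<^sub>0 N)\<close>, with \<open>N\<close> the number of spatial nodes, for which \<open>\<langle>c, \<phi>\<rangle> + a \<Sum>q\<^sub>0\<close> depends only on differences of \<open>\<phi>\<close> within the first and the
  last time slice. By the path bound it is at least \<open>-C\<^sub>1 y\<close>, where \<open>y\<^sup>2\<close> is the sum of the squares of all
  space entries of \<open>\<F> q\<close>. With the constraint function \<open>g\<close>, the sum of \<open>q\<^sub>0 - g\<close> is \<open>-1/8 y\<^sup>2\<close>, so \<open>-a \<Sum>q\<^sub>0\<close>
  produces \<open>a/8 y\<^sup>2\<close>, which beats the linear term, and \<open>-a \<Sum>g\<close>, which controls the negative
  part of \<open>g\<close>; the penalty controls the positive part.\<close>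
lemma sublevel_bounded:
  assumes n: "\<And>d. d \<le> D \<Longrightarrow> n d > 0"
    and \<rho>: "(\<Sum>i\<in>GcX D n. measure \<rho>0 (cell D n i)) = 1" "(\<Sum>i\<in>GcX D n. measure \<rho>1 (cell D n i)) = 1"
  shows "\<exists>R\<ge>0. \<forall>\<phi>. ip (Gc D n) (cvec D n \<rho>0 \<rho>1) \<phi> +
        1/2 * (\<Sum>i\<in>Gs D n 0. (max 0 (constr D n (Aop D n \<phi>) i))\<^sup>2) \<le> 0 \<longrightarrow>
      (\<forall>p\<in>Stag D n. \<bar>Aop D n \<phi> p\<bar> \<le> R)"
proof -
  let ?X = "GcX D n" and ?G = "Gs D n 0"
  have n0: "n 0 > 0" using n by simp
  have "?X \<noteq> {}" using \<rho>(1) by auto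
  then have N: "card ?X > 0" by (simp add: card_gt_0_iff finite_grids)
  define a where "a = 1 / (real (n 0) * real (card ?X))"
  have a: "a > 0" and an: "a * real (n 0) = 1 / real (card ?X)" using n0 N by (auto simp: a_def)
  define w0 where "w0 x = measure \<rho>0 (cell D n x) - 1 / real (card ?X)" for x
  define w1 where "w1 x = measure \<rho>1 (cell D n x) - 1 / real (card ?X)" for x
  have w: "(\<Sum>x\<in>?X. w0 x) = 0" "(\<Sum>x\<in>?X. w1 x) = 0"
    using \<rho> N by (simp_all add: w0_def w1_def sum_subtractf)
  define H where "H = real (\<Sum>d\<in>{1..D}. n d)"
  define C1 where "C1 = ((\<Sum>x\<in>?X. \<bar>w0 x\<bar>) + (\<Sum>x\<in>?X. \<bar>w1 x\<bar>)) * H"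
  define C3 where "C3 = 2 * a\<^sup>2 * real (card ?G) + 2 * (C1 + 1)\<^sup>2 / a"
  define R where "R = C3 + C3 / a + C3\<^sup>2 / 8"
  have C3: "C3 \<ge> 0" using a by (simp add: C3_def)
  show ?thesis
  proof (intro exI[of _ R] conjI allI impI ballI)
    show "0 \<le> R" using C3 a by (simp add: R_def)
    fix \<phi> p
    assume le: "ip (Gc D n) (cvec D n \<rho>0 \<rho>1) \<phi> +
        1/2 * (\<Sum>i\<in>?G. (max 0 (constr D n (Aop D n \<phi>) i))\<^sup>2) \<le> 0" and p: "p \<in> Stag D n"
    define q where "q = Aop D n \<phi>"
    define g where "g = constr D n q"
    define V where "V i = (\<Sum>m=1..4*D. (Fop D n q (m, i))\<^sup>2)" for i
    define W where "W = (\<Sum>i\<in>?G. V i)"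
    define y where "y = sqrt W"
    have V0: "0 \<le> V i" for i by (simp add: V_def sum_nonneg)
    have W0: "0 \<le> W" by (simp add: W_def sum_nonneg V0)
    have y0: "0 \<le> y" and y2: "y\<^sup>2 = W" using W0 by (simp_all add: y_def)
    have qb: "\<bar>q (d, j)\<bar> \<le> y" if dj: "1 \<le> d" "d \<le> D" "j \<in> Gs D n d" for d j
    proof -
      obtain m i where mi: "m \<in> {1..4*D}" "i \<in> ?G" "Fop D n q (m, i) = q (d, j)"
        using Fop_covers[OF n0 dj] by metis
      have "(q (d, j))\<^sup>2 \<le> V i"
        unfolding V_def using member_le_sum[of m "{1..4*D}" "\<lambda>m. (Fop D n q (m, i))\<^sup>2"] mi by simp
      also have "\<dots> \<le> W"
        unfolding W_def using mi by (intro member_le_sum) (auto simp: V0 finite_grids)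
      finally have "sqrt ((q (d, j))\<^sup>2) \<le> sqrt W" by (rule real_sqrt_le_mono)
      then show ?thesis by (simp add: y_def)
    qed
    have slice: "\<bar>\<phi> (x(0 := t)) - \<phi> (\<lambda>k. if k \<in> {1..D} then 0 else if k = 0 then t else undefined)\<bar> \<le> H * y"
      if x: "x \<in> ?X" and t: "t \<in> Jc n 0" for x t
    proof -
      have xt: "x(0 := t) \<in> Gc D n"
        using x t unfolding Gc_iff GcX_iff by (auto split: if_splits)
      have "(\<lambda>k. if k \<in> {1..D} then 0 else (x(0 := t)) k) =
          (\<lambda>k. if k \<in> {1..D} then 0 else if k = 0 then t else undefined)"
        using x unfolding GcX_iff by (intro ext) (auto split: if_splits)
      then show ?thesis
        using grid_path_bound[OF xt, of "{1..D}" \<phi> y] qb y0 by (simp add: H_def q_def)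
    qed
    have t: "0 \<in> Jc n 0" "real (n 0) \<in> Jc n 0" unfolding Jc_iff by auto
    have "ip (Gc D n) (cvec D n \<rho>0 \<rho>1) \<phi> + a * (\<Sum>i\<in>?G. q (0, i)) =
        (\<Sum>x\<in>?X. w0 x * \<phi> (x(0 := 0))) - (\<Sum>x\<in>?X. w1 x * \<phi> (x(0 := real (n 0))))"
      unfolding ip_cvec[where n = n, OF n0] q_def sum_time_differences[where n = n, OF n0] mult.assoc[symmetric] an
      by (simp add: w0_def w1_def left_diff_distrib sum_subtractf right_diff_distrib sum_divide_distrib)
    moreover have "\<bar>\<Sum>x\<in>?X. w0 x * \<phi> (x(0 := 0))\<bar> \<le> (\<Sum>x\<in>?X. \<bar>w0 x\<bar>) * (H * y)"
      by (rule zero_mean_bound[OF w(1) slice[OF _ t(1)]])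
    moreover have "\<bar>\<Sum>x\<in>?X. w1 x * \<phi> (x(0 := real (n 0)))\<bar> \<le> (\<Sum>x\<in>?X. \<bar>w1 x\<bar>) * (H * y)"
      by (rule zero_mean_bound[OF w(2) slice[OF _ t(2)]])
    ultimately have lin: "- (C1 * y) \<le> ip (Gc D n) (cvec D n \<rho>0 \<rho>1) \<phi> + a * (\<Sum>i\<in>?G. q (0, i))"
      by (simp add: C1_def algebra_simps abs_le_iff)
    have q0: "q (0, i) = g i - 1/8 * V i" if "i \<in> ?G" for i
      using constr_Fop[OF that, of q] by (simp add: g_def V_def)
    have sq: "(\<Sum>i\<in>?G. q (0, i)) = (\<Sum>i\<in>?G. g i) - 1/8 * W"
      by (simp add: q0 sum_subtractf W_def sum_divide_distrib cong: sum.cong)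
    \<comment> \<open>Complete the square for \<open>g i \<ge> 0\<close>; for \<open>g i < 0\<close> the penalty is absent and the sign is right.\<close>
    have pen: "a * \<bar>g i\<bar> - 2 * a\<^sup>2 \<le> 1/2 * (max 0 (g i))\<^sup>2 - a * g i" for i
    proof (cases "g i \<ge> 0")
      case True
      have "0 \<le> 1/2 * (g i - 2 * a)\<^sup>2" by simp
      then show ?thesis using True by (simp add: power2_eq_square algebra_simps)
    qed (use a in auto)
    have "a * (\<Sum>i\<in>?G. \<bar>g i\<bar>) - 2 * a\<^sup>2 * real (card ?G) \<le>
        1/2 * (\<Sum>i\<in>?G. (max 0 (g i))\<^sup>2) - a * (\<Sum>i\<in>?G. g i)"
      using sum_mono[of ?G, OF pen] by (simp add: sum_subtractf sum_distrib_left sum_divide_distrib mult.commute)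
    moreover have "y - 2 * (C1 + 1)\<^sup>2 / a \<le> a/8 * y\<^sup>2 - C1 * y"
    proof -
      \<comment> \<open>The square is chosen so that \<open>y\<close> itself is left over on the smaller side.\<close>
      have "0 \<le> a/8 * (y - 4 * (C1 + 1) / a)\<^sup>2" using a by simp
      moreover have "a/8 * (y - 4 * (C1 + 1) / a)\<^sup>2 = a/8 * y\<^sup>2 - (C1 + 1) * y + 2 * (C1 + 1)\<^sup>2 / a"
        using a by (simp add: power2_eq_square field_simps)
      moreover have "(C1 + 1) * y = C1 * y + y" by (simp add: distrib_right)
      ultimately show ?thesis by linarith
    qed
    ultimately have key: "y + a * (\<Sum>i\<in>?G. \<bar>g i\<bar>) \<le> C3"
      using le lin unfolding sq y2 C3_def g_def[symmetric] q_def[symmetric]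
      by (simp add: algebra_simps)
    have gpos: "0 \<le> a * (\<Sum>i\<in>?G. \<bar>g i\<bar>)" using a by (simp add: sum_nonneg)
    have yC: "y \<le> C3" using key gpos by linarith
    have gC: "\<bar>g i\<bar> \<le> C3 / a" if "i \<in> ?G" for i
    proof -
      have "\<bar>g i\<bar> \<le> (\<Sum>i\<in>?G. \<bar>g i\<bar>)" using that by (intro member_le_sum) (auto simp: finite_grids)
      then have "a * \<bar>g i\<bar> \<le> a * (\<Sum>i\<in>?G. \<bar>g i\<bar>)" using a by simp
      then have "a * \<bar>g i\<bar> \<le> C3" using key y0 by linarith
      then show ?thesis using a by (simp add: field_simps)
    qed
    obtain d j where dj: "p = (d, j)" "d \<le> D" "j \<in> Gs D n d" using p by (auto simp: Stag_def)
    show "\<bar>Aop D n \<phi> p\<bar> \<le> R"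
    proof (cases "d = 0")
      case True
      then have j: "j \<in> ?G" using dj by simp
      have "V j \<le> W" unfolding W_def using j by (intro member_le_sum) (auto simp: V0 finite_grids)
      also have "\<dots> \<le> C3\<^sup>2" unfolding y2[symmetric] using yC y0 by (intro power_mono)
      finally have "\<bar>q (0, j)\<bar> \<le> C3 / a + C3\<^sup>2 / 8" using q0[OF j] gC[OF j] V0[of j] by linarith
      then show ?thesis using True dj C3 by (simp add: R_def q_def)
    next
      case False
      have "\<bar>q (d, j)\<bar> \<le> C3" using qb[of d j] False dj yC by simp
      moreover have "C3 / a \<ge> 0" "C3\<^sup>2 / 8 \<ge> 0" using C3 a by auto
      ultimately have "\<bar>q (d, j)\<bar> \<le> R" unfolding R_def by linarith
      then show ?thesis using dj by (simp add: q_def)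
    qed
  qed
qed

section \<open>Existence of a solution\<close>

text \<open>The Slater direction: minus the physical time. Its time difference is \<open>-1\<close> everywhere and it is
  constant in space, so it lowers all constraints at the same rate.\<close>
lemma time_ramp:
  assumes "n 0 > 0"
  defines "e \<equiv> (\<lambda>i. - hstep n 0 * i 0)"
  shows "i \<in> Gs D n 0 \<Longrightarrow> Aop D n e (0, i) = -1"
    and "i \<in> Gs D n 0 \<Longrightarrow> m \<in> {1..4*D} \<Longrightarrow> Fop D n (Aop D n e) (m, i) = 0"
proof -
  show "Aop D n e (0, i) = -1" if "i \<in> Gs D n 0"
    using that assms(1) by (simp add: Aop_def Stag_def e_def hstep_def field_simps)
  assume i: "i \<in> Gs D n 0" and "m \<in> {1..4*D}"
  then obtain d k where dk: "1 \<le> d" "d \<le> D" "1 \<le> k" "k \<le> (4::nat)" "m = 4 * (d - 1) + k"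
    using block_number_cases[of m D] by auto
  have "Fop D n (Aop D n e) (m, i) = Fpart D n d k (\<lambda>j. 0) i"
    unfolding dk(5) Fop_Fpart[OF i dk(1-4)]
    by (rule Fpart_cong[OF i dk(1,2)]) (use dk in \<open>simp add: Aop_def Stag_def e_def\<close>)
  then show "Fop D n (Aop D n e) (m, i) = 0" using i by (simp add: Fpart_def)
qed

lemma multiplier_existence:
  assumes n: "\<And>d. d \<le> D \<Longrightarrow> n d > 0"
    and \<rho>: "(\<Sum>i\<in>GcX D n. measure \<rho>0 (cell D n i)) = 1" "(\<Sum>i\<in>GcX D n. measure \<rho>1 (cell D n i)) = 1"
  shows "\<exists>\<phi> \<nu>. (\<forall>i\<in>Gs D n 0. 0 \<le> \<nu> i \<and> constr D n (Aop D n \<phi>) i \<le> 0 \<and> \<nu> i * constr D n (Aop D n \<phi>) i = 0) \<and>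
    (\<forall>\<psi>. ip (Gc D n) (cvec D n \<rho>0 \<rho>1) \<psi> + (\<Sum>i\<in>Gs D n 0. \<nu> i * (Aop D n \<psi> (0, i) +
        1/4 * (\<Sum>m=1..4*D. Fop D n (Aop D n \<psi>) (m, i) * Fop D n (Aop D n \<phi>) (m, i)))) = 0)"
proof -
  let ?G = "Gs D n 0" and ?M = "{1..4*D}" and ?f = "ip (Gc D n) (cvec D n \<rho>0 \<rho>1)"
  let ?L = "\<lambda>i \<phi>. Aop D n \<phi> (0, i)" and ?B = "\<lambda>i m \<phi>. 1/2 * Fop D n (Aop D n \<phi>) (m, i)"
  have n0: "n 0 > 0" using n by simp
  have q: "quad ?M (?L i) (?B i) \<phi> = constr D n (Aop D n \<phi>) i" if "i \<in> ?G" for i \<phi>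
    using constr_Fop[OF that, of "Aop D n \<phi>"]
    by (simp add: quad_def power_mult_distrib power_divide sum_divide_distrib[symmetric])
  have f: "lin_form (Gc D n) ?f" unfolding lin_form_def ip_def by auto
  have L: "lin_form (Gc D n) (?L i)" if "i \<in> ?G" for i
    using that by (intro Aop_lin) (auto simp: Stag_def)
  have B: "lin_form (Gc D n) (?B i m)" if "i \<in> ?G" "m \<in> ?M" for i m
  proof (rule lin_form_cmult, rule lin_form_compose[OF Fop_lin Aop_lin])
    show "(m, i) \<in> FIdx D n" using that by (auto simp: FIdx_def)
  qed
  obtain R where R: "R \<ge> 0" "\<And>\<phi> p. ?f \<phi> + 1/2 * (\<Sum>i\<in>?G. (max 0 (constr D n (Aop D n \<phi>) i))\<^sup>2) \<le> 0
      \<Longrightarrow> p \<in> Stag D n \<Longrightarrow> \<bar>Aop D n \<phi> p\<bar> \<le> R"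
    using sublevel_bounded[OF n \<rho>] by metis
  let ?H = "real (\<Sum>d\<in>{0..D}. n d) * R"
  have bdd: "\<exists>\<psi>. (\<forall>j\<in>Gc D n. \<bar>\<psi> j\<bar> \<le> ?H) \<and> ?f \<psi> = ?f \<phi> \<and>
      (\<forall>i\<in>?G. quad ?M (?L i) (?B i) \<psi> = quad ?M (?L i) (?B i) \<phi>)"
    if le: "?f \<phi> + 1/2 * (\<Sum>i\<in>?G. (max 0 (quad ?M (?L i) (?B i) \<phi>))\<^sup>2) \<le> 0" for \<phi>
  proof -
    \<comment> \<open>Normalize the potential at the origin of the grid; \<open>c\<close> annihilates constants because the masses agree.\<close>
    define k where "k = \<phi> (\<lambda>d. if d \<in> {0..D} then 0 else undefined)"
    define \<psi> where "\<psi> = (\<lambda>i. \<phi> i - k)"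
    have A: "Aop D n \<psi> = Aop D n \<phi>" by (simp add: Aop_def \<psi>_def)
    have "(\<Sum>i\<in>?G. (max 0 (quad ?M (?L i) (?B i) \<phi>))\<^sup>2) =
        (\<Sum>i\<in>?G. (max 0 (constr D n (Aop D n \<phi>) i))\<^sup>2)"
      by (rule sum.cong) (simp_all only: q)
    then have qb: "\<And>p. p \<in> Stag D n \<Longrightarrow> \<bar>Aop D n \<phi> p\<bar> \<le> R" using R(2) le by simp
    have "\<bar>\<psi> j\<bar> \<le> ?H" if j: "j \<in> Gc D n" for j
    proof -
      have "(\<lambda>d. if d \<in> {0..D} then 0 else j d) = (\<lambda>d. if d \<in> {0..D} then 0 else undefined)"
        using j unfolding Gc_iff by (intro ext) (auto split: if_splits)
      then show ?thesis
        using grid_path_bound[OF j order_refl, of \<phi> R] qb R(1) by (simp add: Stag_def \<psi>_def k_def)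
    qed
    moreover have "?f \<psi> = ?f \<phi>"
      using \<rho> unfolding ip_cvec[where n = n, OF n0] \<psi>_def
      by (simp add: right_diff_distrib sum_subtractf sum_distrib_right[symmetric])
    ultimately show ?thesis by (intro exI[of _ \<psi>]) (simp add: A quad_def)
  qed
  have "?H \<ge> 0" by (intro mult_nonneg_nonneg of_nat_0_le_iff R(1))
  have "\<exists>\<phi> \<nu>. (\<forall>i\<in>?G. 0 \<le> \<nu> i \<and> quad ?M (?L i) (?B i) \<phi> \<le> 0 \<and> \<nu> i * quad ?M (?L i) (?B i) \<phi> = 0) \<and>
      (\<forall>\<psi>. ?f \<psi> + (\<Sum>i\<in>?G. \<nu> i * dquad ?M (?L i) (?B i) \<phi> \<psi>) = 0)"
  proof (rule kkt_by_penalty[OF finite_grids(1) finite_grids(3) f L B _ _ \<open>?H \<ge> 0\<close> bdd])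
    show "Aop D n (\<lambda>i. - hstep n 0 * i 0) (0, i) = -1" if "i \<in> ?G" for i
      using time_ramp(1)[where n = n, OF n0] that .
    show "1/2 * Fop D n (Aop D n (\<lambda>i. - hstep n 0 * i 0)) (m, i) = 0" if "i \<in> ?G" "m \<in> ?M" for i m
      using time_ramp(2)[where n = n, OF n0] that by simp
  qed
  then obtain \<phi> \<nu> where *: "\<And>i. i \<in> ?G \<Longrightarrow> 0 \<le> \<nu> i \<and> quad ?M (?L i) (?B i) \<phi> \<le> 0 \<and> \<nu> i * quad ?M (?L i) (?B i) \<phi> = 0"
    "\<And>\<psi>. ?f \<psi> + (\<Sum>i\<in>?G. \<nu> i * dquad ?M (?L i) (?B i) \<phi> \<psi>) = 0"
    by blast
  have dq: "dquad ?M (?L i) (?B i) \<phi> \<psi> = Aop D n \<psi> (0, i) +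
        1/4 * (\<Sum>m=1..4*D. Fop D n (Aop D n \<psi>) (m, i) * Fop D n (Aop D n \<phi>) (m, i))" for i \<psi>
    by (simp add: dquad_def sum_divide_distrib mult.commute)
  show ?thesis
    using * q unfolding dq by (intro exI[of _ \<phi>] exI[of _ \<nu>]) auto
qed

text \<open>Halved multipliers of the quadratic constraints, times the reflected slack, are dual cone variables:
  reflection preserves the cone, and orthogonality to the slack is complementarity by
  \<open>slack_tail\<close>.\<close>
lemma kkt_soc_nonempty:
  assumes n: "\<And>d. d \<le> D \<Longrightarrow> n d > 0"
    and \<rho>: "(\<Sum>i\<in>GcX D n. measure \<rho>0 (cell D n i)) = 1" "(\<Sum>i\<in>GcX D n. measure \<rho>1 (cell D n i)) = 1"
  shows "kkt_soc D n (cvec D n \<rho>0 \<rho>1) \<noteq> {}"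
proof -
  let ?c = "cvec D n \<rho>0 \<rho>1" and ?G = "Gs D n 0"
  obtain \<phi>' \<nu> where
    \<nu>: "\<And>i. i \<in> ?G \<Longrightarrow> 0 \<le> \<nu> i" and
    feas': "\<And>i. i \<in> ?G \<Longrightarrow> constr D n (Aop D n \<phi>') i \<le> 0" and
    slack': "\<And>i. i \<in> ?G \<Longrightarrow> \<nu> i * constr D n (Aop D n \<phi>') i = 0" and
    stat': "\<And>\<psi>. ip (Gc D n) ?c \<psi> + (\<Sum>i\<in>?G. \<nu> i * (Aop D n \<psi> (0, i) +
        1/4 * (\<Sum>m=1..4*D. Fop D n (Aop D n \<psi>) (m, i) * Fop D n (Aop D n \<phi>') (m, i)))) = 0"
    using multiplier_existence[OF n \<rho>] by blast
  \<comment> \<open>The potential from the penalization is arbitrary off the grid.\<close>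
  define \<phi> where "\<phi> = restrict \<phi>' (Gc D n)"
  define q where "q = Aop D n \<phi>"
  have q': "q = Aop D n \<phi>'"
  proof
    fix p show "q p = Aop D n \<phi>' p"
    proof (cases "p \<in> Stag D n")
      case True
      then show ?thesis unfolding q_def \<phi>_def by (intro lin_form_cong[OF Aop_lin]) auto
    qed (auto simp: q_def Aop_def)
  qed
  note feas = feas'[folded q'] and slack = slack'[folded q'] and stat = stat'[folded q']
  define z where "z = (\<lambda>p\<in>BIdx D n. Bop D n (Fop D n q) p + dvec D n p)"
  define \<beta> where "\<beta> = (\<lambda>(m, i)\<in>BIdx D n. (if m = 1 then 1 else -1) * (\<nu> i / 2 * z (m, i)))"
  define \<alpha> where "\<alpha> = (\<lambda>p\<in>Stag D n. - adj (Stag D n) (FIdx D n) (Fop D n)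
                              (adj (FIdx D n) (BIdx D n) (Bop D n) \<beta>) p)"
  have z: "\<forall>p\<in>BIdx D n. z p = Bop D n (Fop D n q) p + dvec D n p" by (simp add: z_def)
  have zr: "z \<in> rvec (BIdx D n)" by (simp add: z_def rvec_def)
  have zQ: "z \<in> Qcone D n" using slack_in_cone_iff[OF z zr] feas by blast
  have \<alpha>: "\<forall>p\<in>Stag D n. \<alpha> p + adj (Stag D n) (FIdx D n) (Fop D n)
                              (adj (FIdx D n) (BIdx D n) (Bop D n) \<beta>) p = 0" by (simp add: \<alpha>_def)
  have \<beta>1: "\<forall>i\<in>?G. \<beta> (1, i) = \<nu> i / 2 * z (1, i)" by (simp add: \<beta>_def BIdx_def)
  have \<beta>2: "\<forall>i\<in>?G. \<forall>k\<in>{1..4*D+1}. \<beta> (k + 1, i) = - (\<nu> i / 2 * z (k + 1, i))"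
    by (auto simp: \<beta>_def BIdx_def)
  have \<beta>sq: "(\<Sum>k=1..4*D+1. (\<beta> (k + 1, i))\<^sup>2) = (\<nu> i / 2)\<^sup>2 * (\<Sum>k=1..4*D+1. (z (k + 1, i))\<^sup>2)"
    if "i \<in> ?G" for i
    unfolding sum_distrib_left using \<beta>2 that by (intro sum.cong) (auto simp: power_mult_distrib power_divide)
  have "0 \<le> \<beta> (1, i) \<and> (\<Sum>k=1..4*D+1. (\<beta> (k + 1, i))\<^sup>2) \<le> (\<beta> (1, i))\<^sup>2" if i: "i \<in> ?G" for i
  proof -
    have zi: "0 \<le> z (1, i)" "(\<Sum>k=1..4*D+1. (z (k + 1, i))\<^sup>2) \<le> (z (1, i))\<^sup>2"
      using zQ i unfolding Qcone_iff by blast+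
    have "(\<nu> i / 2)\<^sup>2 * (\<Sum>k=1..4*D+1. (z (k + 1, i))\<^sup>2) \<le> (\<nu> i / 2)\<^sup>2 * (z (1, i))\<^sup>2"
      by (rule mult_left_mono[OF zi(2)]) simp
    then show ?thesis
      unfolding \<beta>sq[OF i] bspec[OF \<beta>1 i] power_mult_distrib using zi(1) \<nu>[OF i] by (intro conjI) auto
  qed
  then have \<beta>Q: "\<beta> \<in> Qcone D n" unfolding Qcone_iff by (auto simp: \<beta>_def rvec_def)
  have comp: "ip (BIdx D n) z \<beta> = 0"
    unfolding ip_def sum_BIdx
  proof (rule sum.neutral, rule ballI)
    fix i assume i: "i \<in> ?G"
    have "(\<Sum>k=1..4*D+1. z (k + 1, i) * \<beta> (k + 1, i)) = (\<Sum>k=1..4*D+1. - (\<nu> i / 2) * (z (k + 1, i))\<^sup>2)"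
      using \<beta>2 i by (intro sum.cong) (auto simp: power2_eq_square)
    then have "z (1, i) * \<beta> (1, i) + (\<Sum>k=1..4*D+1. z (k + 1, i) * \<beta> (k + 1, i)) =
        \<nu> i / 2 * ((z (1, i))\<^sup>2 - (\<Sum>k=1..4*D+1. (z (k + 1, i))\<^sup>2))"
      unfolding sum_distrib_left[symmetric] bspec[OF \<beta>1 i] by (simp only: power2_eq_square algebra_simps)
    also have "\<dots> = 0" unfolding slack_tail[OF z i] using slack[OF i] by simp
    finally show "z (1, i) * \<beta> (1, i) + (\<Sum>k=1..4*D+1. z (k + 1, i) * \<beta> (k + 1, i)) = 0" .
  qed
  have "adj (Gc D n) (Stag D n) (Aop D n) \<alpha> i = - ?c i" if i: "i \<in> Gc D n" for i
  proof -
    let ?u = "unitv (Gc D n) i"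
    have "adj (Gc D n) (Stag D n) (Aop D n) \<alpha> i = ip (Stag D n) (Aop D n ?u) \<alpha>"
      unfolding adjoint_identities by (simp add: ip_unitv finite_grids i)
    also have "\<dots> = (\<Sum>j\<in>?G. \<nu> j * (Aop D n ?u (0, j) +
        1/4 * (\<Sum>m=1..4*D. Fop D n (Aop D n ?u) (m, j) * Fop D n q (m, j))))"
      unfolding reflected_multiplier_weak_form[OF z \<alpha> \<beta>1 \<beta>2] by simp
    also have "\<dots> = - ip (Gc D n) ?c ?u" using stat[of ?u] by linarith
    also have "ip (Gc D n) ?c ?u = ip (Gc D n) ?u ?c" by (simp add: ip_def mult.commute)
    also have "\<dots> = ?c i" by (rule ip_unitv[OF finite_grids(1) i])
    finally show ?thesis .
  qed
  then have "(\<phi>, z, q, \<alpha>, \<beta>) \<in> kkt_soc D n ?c"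
    unfolding kkt_soc_def using zr zQ z \<alpha> \<beta>Q comp
    by (auto simp: q_def \<phi>_def \<alpha>_def \<beta>_def rvec_def Aop_def)
  then show ?thesis by blast
qed

section \<open>Solutions of the cone program and of the transport problem\<close>

theorem proposition3p3:
  fixes D :: nat and n :: "nat \<Rightarrow> nat" and \<rho>0 \<rho>1 :: "(nat \<Rightarrow> real) measure"
  assumes "D \<ge> 1"
    and "\<And>d. d \<le> D \<Longrightarrow> n d > 0"
    and "borel_prob D \<rho>0" and "borel_prob D \<rho>1"
    and "(\<Sum>i\<in>GcX D n. measure \<rho>0 (cell D n i)) = 1"
    and "(\<Sum>i\<in>GcX D n. measure \<rho>1 (cell D n i)) = 1"
  shows "kkt_soc D n (cvec D n \<rho>0 \<rho>1) \<noteq> {} \<and>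
    (\<forall>\<phi> z q \<alpha> \<beta> \<alpha>0 \<alpha>b.
       (\<phi>, z, q, \<alpha>, \<beta>) \<in> kkt_soc D n (cvec D n \<rho>0 \<rho>1) \<longrightarrow>
       \<alpha>0 \<in> rvec (Gs D n 0) \<longrightarrow> \<alpha>b \<in> rvec (StagX D n) \<longrightarrow> \<alpha> = join_blocks D n \<alpha>0 \<alpha>b \<longrightarrow>
       (\<phi>, q, \<alpha>0, \<alpha>b, (\<lambda>i\<in>Gs D n 0. - \<alpha>0 i)) \<in> kkt_dot D n (cvec D n \<rho>0 \<rho>1))"
  using kkt_soc_nonempty[OF assms(2,5,6)] kkt_soc_imp_kkt_dot by blast

end
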